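(* Let $1 \le d < d_1$ and put $\ell = d$. Then every minimal weight codeword of $C_{\mathcal{X}}(d)$ (that is, every nonzero $f \in C_{\mathcal{X}}(d)$ with $|f| = \delta_{\mathcal{X}}(d)$) is $\mathcal{X}$-equivalent to a function of the form $$ \sigma \prod_{i=1}^{\ell} (x_1 - \alpha_i), $$ with $\sigma \in \mathbb{F}_q^*$, $\alpha_i \in K_1$ for all $i$, and $\alpha_i \neq \alpha_j$ for $1 \le i \neq j \le \ell$.
   Context: $\mathbb{F}_q$ is a finite field with $q$ elements, $n \ge 1$, and $K_1 \subset K_2 \subset \cdots \subset K_n \subset \mathbb{F}_q$ are subfields (inclusions need not be proper). Put $d_i = |K_i|$ and $\mathcal{X} = K_1 \times \cdots \times K_n \subset \mathbb{F}_q^n$. $C_{\mathcal{X}}$ is the $\mathbb{F}_q$-algebra of all functions $\mathcal{X} \to \mathbb{F}_q$. Each $f \in C_{\mathcal{X}}$ is induced by a unique polynomial $P \in \mathbb{F}_q[X_1,\ldots,X_n]$ whose degree in $X_i$ is less than $d_i$ for all $i$ (the reduced polynomial of $f$); the degree of $f$ is $\deg P$. $C_{\mathcal{X}}(d)$ is the $\mathbb{F}_q$-vector space of functions of degree at most $d$, together with the zero function. $|f|$ is the number of points of $\mathcal{X}$ where $f$ is nonzero, and $\delta_{\mathcal{X}}(d) = \min\{|f| : f \in C_{\mathcal{X}}(d),\ f \ne 0\}$. $x_i$ denotes the $i$-th coordinate function restricted to $\mathcal{X}$. $\mathrm{Aff}(n,\mathbb{F}_q)$ is the group of maps $\alpha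 \mapsto A\alpha + \beta$ of $\mathbb{F}_q^n$ with $A \in GL(n,\mathbb{F}_q)$, $\beta \in \mathbb{F}_q^n$, and $\mathrm{Aff}(\mathcal{X})$ is the set of restrictions $\psi|_{\mathcal{X}} : \mathcal{X} \to \mathcal{X}$ of those $\psi \in \mathrm{Aff}(n,\mathbb{F}_q)$ with $\psi(\mathcal{X}) = \mathcal{X}$. Functions $f, g \in C_{\mathcal{X}}$ are $\mathcal{X}$-equivalent if $f = g \circ \varphi$ for some $\varphi \in \mathrm{Aff}(\mathcal{X})$. *)

theory Defs
  imports "HOL-Analysis.Analysis" "HOL-Library.Poly_Mapping"
begin

text \<open>Points of the affine space of dimension n over the finite field are vectors of type
  \<open>'a ^ 'n\<close>.  The index type \<open>'n\<close> is a finite linear order, so its elements play the role of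
  the indices 1, ..., n (with n at least 1), the least of them being the index 1.\<close>

definition first_index :: "'n::{finite,linorder}" where
  "first_index = Min UNIV"

definition subfield_of_type :: "'a::field set \<Rightarrow> bool" where
  "subfield_of_type K \<longleftrightarrow>
     0 \<in> K \<and> 1 \<in> K \<and>
     (\<forall>a\<in>K. \<forall>b\<in>K. a + b \<in> K \<and> a * b \<in> K) \<and>
     (\<forall>a\<in>K. - a \<in> K \<and> inverse a \<in> K)"

definition cart_prod :: "('n::finite \<Rightarrow> 'a set) \<Rightarrow> ('a ^ 'n) set" where
  "cart_prod K = {x. \<forall>i. x $ i \<in> K i}"

text \<open>Polynomials in the variables indexed by \<open>'n\<close>: finitely supported maps from exponent
  vectors to coefficients.\<close>

type_synonym ('n, 'a) mpol = "('n \<Rightarrow>\<^sub>0 nat) \<Rightarrow>\<^sub>0 'a"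

definition mpol_eval :: "('n::finite, 'a::comm_semiring_1) mpol \<Rightarrow> 'a ^ 'n \<Rightarrow> 'a" where
  "mpol_eval P x =
     (\<Sum>m\<in>Poly_Mapping.keys P.
        Poly_Mapping.lookup P m * (\<Prod>i\<in>UNIV. (x $ i) ^ Poly_Mapping.lookup m i))"

text \<open>Both degrees take the value 0 on the zero polynomial.\<close>

definition mpol_total_degree :: "('n::finite, 'a::zero) mpol \<Rightarrow> nat" where
  "mpol_total_degree P =
     Max (insert 0 ((\<lambda>m. \<Sum>i\<in>UNIV. Poly_Mapping.lookup m i) ` Poly_Mapping.keys P))"

definition mpol_degree_in :: "'n \<Rightarrow> ('n::finite, 'a::zero) mpol \<Rightarrow> nat" where
  "mpol_degree_in i P =
     Max (insert 0 ((\<lambda>m. Poly_Mapping.lookup m i) ` Poly_Mapping.keys P))"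

text \<open>A function on \<open>cart_prod K\<close> is an extensional one (\<open>undefined\<close> outside \<open>cart_prod K\<close>),
  so that equality in \<open>code_algebra K\<close> is equality on \<open>cart_prod K\<close>.\<close>

definition code_algebra :: "('n::finite \<Rightarrow> 'a set) \<Rightarrow> ('a ^ 'n \<Rightarrow> 'a) set" where
  "code_algebra K = cart_prod K \<rightarrow>\<^sub>E UNIV"

definition zero_fun :: "('n::finite \<Rightarrow> 'a::zero set) \<Rightarrow> 'a ^ 'n \<Rightarrow> 'a" where
  "zero_fun K = (\<lambda>x\<in>cart_prod K. 0)"

text \<open>When the \<open>K i\<close> are subfields, the polynomial described here exists and is unique for every
  \<open>f\<close> in \<open>code_algebra K\<close>.\<close>

definition reduced_poly ::
    "('n::finite \<Rightarrow> 'a::{field,finite} set) \<Rightarrow> ('a ^ 'n \<Rightarrow> 'a) \<Rightarrow> ('n, 'a) mpol" where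
  "reduced_poly K f =
     (THE P. (\<forall>i. mpol_degree_in i P < card (K i)) \<and>
             (\<forall>x\<in>cart_prod K. f x = mpol_eval P x))"

definition fun_degree ::
    "('n::finite \<Rightarrow> 'a::{field,finite} set) \<Rightarrow> ('a ^ 'n \<Rightarrow> 'a) \<Rightarrow> nat" where
  "fun_degree K f = mpol_total_degree (reduced_poly K f)"

definition code ::
    "('n::finite \<Rightarrow> 'a::{field,finite} set) \<Rightarrow> nat \<Rightarrow> ('a ^ 'n \<Rightarrow> 'a) set" where
  "code K d = {f \<in> code_algebra K. fun_degree K f \<le> d} \<union> {zero_fun K}"

definition weight :: "('n::finite \<Rightarrow> 'a::zero set) \<Rightarrow> ('a ^ 'n \<Rightarrow> 'a) \<Rightarrow> nat" where
  "weight K f = card {x \<in> cart_prod K. f x \<noteq> 0}"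

definition min_weight :: "('n::finite \<Rightarrow> 'a::{field,finite} set) \<Rightarrow> nat \<Rightarrow> nat" where
  "min_weight K d = Min (weight K ` (code K d - {zero_fun K}))"

definition affine_group :: "('a::field ^ 'n::finite \<Rightarrow> 'a ^ 'n) set" where
  "affine_group = {(\<lambda>x. A *v x + b) | A b. invertible A}"

definition affine_group_on ::
    "('n::finite \<Rightarrow> 'a::field set) \<Rightarrow> ('a ^ 'n \<Rightarrow> 'a ^ 'n) set" where
  "affine_group_on K =
     {restrict \<psi> (cart_prod K) | \<psi>. \<psi> \<in> affine_group \<and> \<psi> ` cart_prod K = cart_prod K}"

definition code_equiv ::
    "('n::finite \<Rightarrow> 'a::field set) \<Rightarrow> ('a ^ 'n \<Rightarrow> 'a) \<Rightarrow> ('a ^ 'n \<Rightarrow> 'a) \<Rightarrow> bool" where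
  "code_equiv K f g \<longleftrightarrow> (\<exists>\<phi>\<in>affine_group_on K. f = compose (cart_prod K) g \<phi>)"

end

(* The inclusions K_1 <= K_i make X = K_1 x ... x K_n a vector space over K_1.  A nonzero function of
   degree at most d has at most d |X| / s zeros on X, where s = |K_1|, and the same bound holds
   proportionally on every K_1-flat (Schwartz-Zippel).  For a codeword of minimal weight this is an
   equality.  Let W be a maximal flat in its zero set Z: a flat of one dimension more containing W
   has at most d |W| zeros, and counting Z through all such flats forces W to be a hyperplane.
   If exactly k >= 1 translates of W lie in Z, then f has degree at most d - k on the other s - k
   translates, so d s <= k s + (s - k)(d - k), i.e. k = d, and f = c * prod (L - alpha) for a
   K_1-linear form L on X.  If L did not vanish on an axis with K_i strictly larger than K_1, then f
   would have more than d zeros on this axis.  So L involves only coordinates with K_i = K_1, has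
   coefficients in K_1, and can be moved to x_1 by an element of Aff(X). *)

theory Submission
  imports Defs
begin

subsection \<open>Polynomial functions\<close>

text \<open>The index is a degree bound for a function on the whole space, not an exact degree, and
  no monomials occur. Facts about lines and degrees can thus be proved by rule induction.\<close>

inductive poly_fun :: "nat \<Rightarrow> ('a::field ^ 'n::finite \<Rightarrow> 'a) \<Rightarrow> bool" where
  const: "poly_fun d (\<lambda>x. c)"
| add: "poly_fun d f \<Longrightarrow> poly_fun d g \<Longrightarrow> poly_fun d (\<lambda>x. f x + g x)"
| coord: "poly_fun d f \<Longrightarrow> poly_fun (Suc d) (\<lambda>x. x $ i * f x)"

lemma poly_fun_mono:
  assumes "poly_fun d f" "d \<le> e"
  shows "poly_fun e f"
  using assms
proof (induction arbitrary: e rule: poly_fun.induct)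
  case (coord d f i)
  then obtain e' where "e = Suc e'" "d \<le> e'" by (cases e) auto
  then show ?case using coord.IH poly_fun.coord by blast
qed (auto intro: poly_fun.intros)

lemma poly_fun_0:
  assumes "poly_fun 0 f"
  shows "\<exists>c. f = (\<lambda>x. c)"
  using assms by (induction "0::nat" f rule: poly_fun.induct) auto

lemma poly_fun_cmult:
  assumes "poly_fun d f"
  shows "poly_fun d (\<lambda>x. c * f x)"
  using assms
proof induction
  case (const d c')
  then show ?case by (rule poly_fun.const)
next
  case (add d f g)
  then show ?case using poly_fun.add by (simp add: distrib_left)
next
  case (coord d f i)
  then show ?case using poly_fun.coord[OF coord.IH, of i] by (simp add: mult.left_commute)
qed

lemma poly_fun_sum:
  assumes "\<And>j. j \<in> A \<Longrightarrow> poly_fun d (f j)"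
  shows "poly_fun d (\<lambda>x. \<Sum>j\<in>A. f j x)"
  using assms by (induction A rule: infinite_finite_induct) (auto intro: poly_fun.intros)

lemma poly_fun_coord_power:
  assumes "poly_fun d f"
  shows "poly_fun (k + d) (\<lambda>x. (x $ i) ^ k * f x)"
proof (induction k)
  case (Suc k)
  then show ?case using poly_fun.coord[OF Suc, of i] by (simp add: mult.assoc)
qed (use assms in simp)

lemma poly_fun_monomial: "poly_fun (\<Sum>i\<in>A. m i) (\<lambda>x. \<Prod>i\<in>A. (x $ i) ^ m i)"
proof (induction A rule: infinite_finite_induct)
  case (insert i A)
  then show ?case using poly_fun_coord_power[OF insert.IH, of "m i" i] by simp
qed (auto intro: poly_fun.const)

text \<open>Taylor expansion in the direction \<open>v\<close>: the coefficient of
  \<open>t ^ j\<close> loses \<open>j\<close> degrees. This drop in degree drives both the zero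
  bound and the analysis of the extremal case.\<close>

lemma poly_fun_line:
  assumes "poly_fun d f"
  shows "\<exists>c. (\<forall>j\<le>d. poly_fun (d - j) (c j)) \<and>
             (\<forall>x t. f (x + t *s v) = (\<Sum>j\<le>d. t ^ j * c j x))"
  using assms
proof induction
  case (const d a)
  have "(\<Sum>j\<le>d. t ^ j * (if j = 0 then a else 0)) = a" for t :: 'a
    by (subst sum.remove[of _ 0]) auto
  then show ?case
    by (intro exI[of _ "\<lambda>j x. if j = 0 then a else 0"]) (auto intro: poly_fun.const)
next
  case (add d f g)
  then obtain c c' where
    "\<forall>j\<le>d. poly_fun (d - j) (c j)" "\<forall>x t. f (x + t *s v) = (\<Sum>j\<le>d. t ^ j * c j x)"
    "\<forall>j\<le>d. poly_fun (d - j) (c' j)" "\<forall>x t. g (x + t *s v) = (\<Sum>j\<le>d. t ^ j * c' j x)"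
    by blast
  then show ?case
    by (intro exI[of _ "\<lambda>j x. c j x + c' j x"])
      (auto intro: poly_fun.add simp: distrib_left sum.distrib)
next
  case (coord d f i)
  then obtain c where c: "\<And>j. j \<le> d \<Longrightarrow> poly_fun (d - j) (c j)"
    and f: "\<And>x t. f (x + t *s v) = (\<Sum>j\<le>d. t ^ j * c j x)"
    by blast
  \<comment> \<open>The factor \<open>x $ i + t * v $ i\<close> splits the product: \<open>a\<close>
    keeps the power of \<open>t\<close> and is padded by zero at index \<open>Suc d\<close>, while
    \<open>b\<close> raises the power by one.\<close>
  define a where "a j = (if j \<le> d then (\<lambda>x. x $ i * c j x) else (\<lambda>x. 0))" for j
  define b where "b j = (case j of 0 \<Rightarrow> (\<lambda>x. 0) | Suc k \<Rightarrow> (\<lambda>x. v $ i * c k x))" for j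
  have "poly_fun (Suc d - j) (a j)" for j
    using poly_fun.coord[OF c, of j i]
    by (auto simp: a_def Suc_diff_le intro: poly_fun.const)
  moreover have "poly_fun (Suc d - j) (b j)" if "j \<le> Suc d" for j
    using that by (cases j) (auto simp: b_def intro: poly_fun.const poly_fun_cmult c)
  moreover have "(x + t *s v) $ i * f (x + t *s v) = (\<Sum>j\<le>Suc d. t ^ j * (a j x + b j x))" for x t
  proof -
    have "(\<Sum>j\<le>Suc d. t ^ j * a j x) = x $ i * f (x + t *s v)"
      by (simp add: a_def f sum_distrib_left mult.left_commute)
    moreover have "(\<Sum>j\<le>Suc d. t ^ j * b j x) = t * v $ i * f (x + t *s v)"
      by (subst sum.atMost_Suc_shift) (simp add: b_def f sum_distrib_left mult_ac)
    ultimately show ?thesis by (simp add: distrib_left sum.distrib distrib_right)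
  qed
  ultimately show ?case
    by (intro exI[of _ "\<lambda>j x. a j x + b j x"]) (auto intro: poly_fun.add)
qed

section \<open>Roots and interpolation in one variable\<close>

lemma card_roots_le:
  fixes b :: "nat \<Rightarrow> 'a::{field,finite}"
  assumes "b k \<noteq> 0"
  shows "card {t \<in> A. (\<Sum>j\<le>k. t ^ j * b j) = 0} \<le> k"
proof -
  define p where "p = (\<Sum>j\<le>k. monom (b j) j)"
  have p: "poly p t = (\<Sum>j\<le>k. t ^ j * b j)" for t
    by (simp add: p_def poly_sum poly_monom mult.commute)
  have "coeff p k = b k" by (simp add: p_def coeff_sum)
  then have "p \<noteq> 0" using assms by auto
  have "degree p \<le> k" unfolding p_def
    by (intro degree_sum_le) (auto intro: order.trans[OF degree_monom_le])
  moreover have "card {t \<in> A. (\<Sum>j\<le>k. t ^ j * b j) = 0} \<le> card {t. poly p t = 0}"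
    by (intro card_mono) (auto simp: p)
  ultimately show ?thesis using card_poly_roots_bound[OF \<open>p \<noteq> 0\<close>] by linarith
qed

text \<open>The weights are the Lagrange basis polynomials of the nodes \<open>T\<close>, evaluated
  at \<open>x\<close>; interpolation at \<open>card T\<close> nodes is exact on powers below
  \<open>card T\<close>.\<close>

lemma lagrange_weights:
  fixes x :: "'a::field"
  assumes "finite T"
  shows "\<exists>w. \<forall>j<card T. (\<Sum>a\<in>T. w a * a ^ j) = x ^ j"
  using assms
proof induction
  case (insert b T)
  then obtain w where w: "\<And>j. j < card T \<Longrightarrow> (\<Sum>a\<in>T. w a * a ^ j) = x ^ j" by blast
  \<comment> \<open>When the node \<open>b\<close> joins, the basis polynomial of \<open>a\<close>
    gains the factor \<open>(x - b) / (a - b)\<close>. The weight of \<open>b\<close> itself is then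
    fixed by exponent 0.\<close>
  define u where "u a = w a * (x - b) / (a - b)" for a
  define w' where "w' a = (if a = b then 1 - (\<Sum>a\<in>T. u a) else u a)" for a
  have w'T: "(\<Sum>a\<in>T. w' a * a ^ j) = (\<Sum>a\<in>T. u a * a ^ j)" for j
    using insert by (intro sum.cong) (auto simp: w'_def)
  have "(\<Sum>a\<in>insert b T. w' a * a ^ j) = x ^ j" if "j < Suc (card T)" for j
    using that
  proof (induction j)
    case 0
    then show ?case using insert w'T[of 0] by (simp add: w'_def)
  next
    case (Suc j)
    \<comment> \<open>The factor \<open>a - b\<close> cancels the denominator of \<open>u a\<close>,
      which brings back the old weights and hence a recursion in \<open>j\<close>.\<close>
    have "(\<Sum>a\<in>T. u a * a ^ Suc j) - b * (\<Sum>a\<in>T. u a * a ^ j) = (\<Sum>a\<in>T. u a * (a - b) * a ^ j)"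
      by (simp add: sum_distrib_left sum_subtractf[symmetric] algebra_simps)
    also have "\<dots> = (\<Sum>a\<in>T. (x - b) * (w a * a ^ j))"
      using insert by (intro sum.cong) (auto simp: u_def)
    also have "\<dots> = (x - b) * x ^ j" using w Suc by (simp add: sum_distrib_left[symmetric])
    finally have shift: "(\<Sum>a\<in>T. u a * a ^ Suc j) = b * (\<Sum>a\<in>T. u a * a ^ j) + (x - b) * x ^ j"
      by (simp only: diff_eq_eq add.commute)
    have IH: "w' b * b ^ j + (\<Sum>a\<in>T. u a * a ^ j) = x ^ j"
      using Suc insert.hyps by (simp add: w'T)
    have "(\<Sum>a\<in>insert b T. w' a * a ^ Suc j) = w' b * b ^ Suc j + (\<Sum>a\<in>T. u a * a ^ Suc j)"
      by (simp only: sum.insert[OF insert.hyps(1,2)] w'T)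
    also have "\<dots> = b * (w' b * b ^ j + (\<Sum>a\<in>T. u a * a ^ j)) + (x - b) * x ^ j"
      unfolding shift by (simp only: distrib_left power_Suc mult.left_commute add.assoc)
    also have "\<dots> = x ^ Suc j" unfolding IH by (simp add: left_diff_distrib)
    finally show ?case .
  qed
  then show ?case using insert by auto
qed auto

subsection \<open>Subspaces over a subfield\<close>

locale finite_subfield =
  fixes K :: "'a::{field,finite} set"
  assumes subfield: "subfield_of_type K"
begin

lemma zero_closed [simp]: "0 \<in> K" and one_closed [simp]: "1 \<in> K"
  and add_closed: "a \<in> K \<Longrightarrow> b \<in> K \<Longrightarrow> a + b \<in> K"
  and mult_closed: "a \<in> K \<Longrightarrow> b \<in> K \<Longrightarrow> a * b \<in> K"
  and minus_closed: "a \<in> K \<Longrightarrow> - a \<in> K"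
  and inverse_closed: "a \<in> K \<Longrightarrow> inverse a \<in> K"
  using subfield by (auto simp: subfield_of_type_def)

lemma diff_closed: "a \<in> K \<Longrightarrow> b \<in> K \<Longrightarrow> a - b \<in> K"
  using add_closed[of a "- b"] minus_closed by simp

lemma card_gt_1: "1 < card K"
proof -
  have "card {0, 1::'a} \<le> card K" by (intro card_mono) auto
  then show ?thesis by simp
qed

text \<open>Scalars are restricted to \<open>K\<close>: the product X is closed under scaling by the
  smallest subfield, but in general not by the whole field.\<close>

definition subspace_over :: "('a ^ 'n::finite) set \<Rightarrow> bool" where
  "subspace_over U \<longleftrightarrow> 0 \<in> U \<and> (\<forall>x\<in>U. \<forall>y\<in>U. x + y \<in> U) \<and> (\<forall>t\<in>K. \<forall>x\<in>U. t *s x \<in> U)"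

definition adjoin :: "('a ^ 'n::finite) set \<Rightarrow> 'a ^ 'n \<Rightarrow> ('a ^ 'n) set" where
  "adjoin U v = (\<lambda>(u, t). u + t *s v) ` (U \<times> K)"

text \<open>Dimension is recorded by a chain of one-vector extensions instead of a basis; each
  extension is one induction step of \<open>schwartz_zippel\<close>.\<close>

inductive has_dim :: "nat \<Rightarrow> ('a ^ 'n::finite) set \<Rightarrow> bool" where
  zero: "has_dim 0 {0}"
| adjoin: "has_dim m U \<Longrightarrow> v \<notin> U \<Longrightarrow> has_dim (Suc m) (adjoin U v)"

lemma subspace_overD:
  assumes "subspace_over U"
  shows "0 \<in> U" "x \<in> U \<Longrightarrow> y \<in> U \<Longrightarrow> x + y \<in> U" "t \<in> K \<Longrightarrow> x \<in> U \<Longrightarrow> t *s x \<in> U"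
    "x \<in> U \<Longrightarrow> - x \<in> U" "x \<in> U \<Longrightarrow> y \<in> U \<Longrightarrow> x - y \<in> U"
proof -
  show *: "0 \<in> U" "x \<in> U \<Longrightarrow> y \<in> U \<Longrightarrow> x + y \<in> U" "t \<in> K \<Longrightarrow> x \<in> U \<Longrightarrow> t *s x \<in> U" for x y t
    using assms by (auto simp: subspace_over_def)
  have **: "- x \<in> U" if "x \<in> U" for x
    using *(3)[OF minus_closed[OF one_closed] that] by (simp add: vector_sneg_minus1[symmetric])
  then show "x \<in> U \<Longrightarrow> - x \<in> U" .
  show "x \<in> U \<Longrightarrow> y \<in> U \<Longrightarrow> x - y \<in> U"
    using *(2)[of x "- y"] ** by simp
qed

lemma adjoinI: "u \<in> U \<Longrightarrow> t \<in> K \<Longrightarrow> u + t *s v \<in> adjoin U v"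
  by (auto simp: adjoin_def)

lemma adjoinE:
  assumes "x \<in> adjoin U v"
  obtains u t where "u \<in> U" "t \<in> K" "x = u + t *s v"
  using assms by (auto simp: adjoin_def)

lemma subset_adjoin: "U \<subseteq> adjoin U v"
proof
  fix x assume "x \<in> U"
  then show "x \<in> adjoin U v" using adjoinI[of x U 0 v] by simp
qed

lemma adjoin_subset: "subspace_over V \<Longrightarrow> U \<subseteq> V \<Longrightarrow> v \<in> V \<Longrightarrow> adjoin U v \<subseteq> V"
  by (auto simp: adjoin_def intro!: subspace_overD)

lemma subspace_over_adjoin:
  assumes "subspace_over U"
  shows "subspace_over (adjoin U v)"
  unfolding subspace_over_def
proof safe
  show "0 \<in> adjoin U v" using subset_adjoin subspace_overD(1)[OF assms] by blast
next
  fix x y assume "x \<in> adjoin U v" "y \<in> adjoin U v"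
  then obtain u t u' t' where *: "u \<in> U" "t \<in> K" "x = u + t *s v" "u' \<in> U" "t' \<in> K" "y = u' + t' *s v"
    by (elim adjoinE)
  then have "x + y = (u + u') + (t + t') *s v"
    by (simp add: vector_sadd_rdistrib algebra_simps)
  then show "x + y \<in> adjoin U v"
    using * by (metis adjoinI add_closed subspace_overD(2)[OF assms])
next
  fix r x assume r: "r \<in> K" and "x \<in> adjoin U v"
  then obtain u t where *: "u \<in> U" "t \<in> K" "x = u + t *s v" by (elim adjoinE)
  then have "r *s x = r *s u + (r * t) *s v"
    by (simp add: vector_add_ldistrib vector_smult_assoc)
  then show "r *s x \<in> adjoin U v"
    using * r by (metis adjoinI mult_closed subspace_overD(3)[OF assms])
qed

lemma has_dim_subspace: "has_dim m U \<Longrightarrow> subspace_over U"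
proof (induction rule: has_dim.induct)
  case zero
  then show ?case by (simp add: subspace_over_def)
qed (rule subspace_over_adjoin)

lemma scaled_mem_iff:
  assumes "subspace_over U" "t \<in> K" "t \<noteq> 0"
  shows "t *s v \<in> U \<longleftrightarrow> v \<in> U"
proof
  assume "t *s v \<in> U"
  then have "inverse t *s (t *s v) \<in> U" using assms inverse_closed subspace_overD(3) by blast
  then show "v \<in> U" using assms by (simp add: vector_smult_assoc)
qed (use assms subspace_overD(3) in blast)

lemma adjoin_coords_unique:
  assumes "subspace_over U" "v \<notin> U" "u \<in> U" "u' \<in> U" "t \<in> K" "t' \<in> K"
    "u + t *s v = u' + t' *s v"
  shows "u = u' \<and> t = t'"
proof -
  have "(t - t') *s v = u' - u"
    using assms(7) by (simp add: vec_eq_iff algebra_simps)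
  then have "(t - t') *s v \<in> U" using subspace_overD(5)[OF assms(1)] assms by metis
  then have "t = t'" using scaled_mem_iff[OF assms(1) diff_closed] assms by auto
  then show ?thesis using assms by simp
qed

lemma bij_betw_adjoin:
  assumes "subspace_over U" "v \<notin> U"
  shows "bij_betw (\<lambda>(u, t). u + t *s v) (U \<times> K) (adjoin U v)"
  unfolding bij_betw_def adjoin_def
  using adjoin_coords_unique[OF assms] by (auto simp: inj_on_def)

lemma card_adjoin: "subspace_over U \<Longrightarrow> v \<notin> U \<Longrightarrow> card (adjoin U v) = card U * card K"
  using bij_betw_same_card[OF bij_betw_adjoin, of U v] by (simp add: card_cartesian_product)

lemma card_adjoin_filter:
  assumes "subspace_over U" "v \<notin> U"
  shows "card {x \<in> adjoin U v. P x} = card {z \<in> U \<times> K. P (fst z + snd z *s v)}"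
proof -
  have "bij_betw (\<lambda>(u, t). u + t *s v) {z \<in> U \<times> K. P (fst z + snd z *s v)} {x \<in> adjoin U v. P x}"
    by (rule bij_betw_subset[OF bij_betw_adjoin[OF assms]]) (auto simp: adjoin_def)
  then show ?thesis by (simp add: bij_betw_same_card)
qed

text \<open>Among the subspaces of \<open>V\<close> that have a dimension take a maximal one; a
  vector of \<open>V\<close> outside it could still be adjoined.\<close>

lemma exists_has_dim:
  assumes "subspace_over V"
  shows "\<exists>m. has_dim m V"
proof -
  define S where "S = {U. (\<exists>m. has_dim m U) \<and> U \<subseteq> V}"
  have "{0} \<in> S" using has_dim.zero subspace_overD(1)[OF assms] by (auto simp: S_def)
  then obtain U where U: "U \<in> S" "\<And>W. W \<in> S \<Longrightarrow> U \<subseteq> W \<Longrightarrow> W = U"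
    using finite_has_maximal[of S] by (metis empty_iff finite)
  then obtain m where m: "has_dim m U" "U \<subseteq> V" by (auto simp: S_def)
  have "V \<subseteq> U"
  proof
    fix v assume v: "v \<in> V"
    show "v \<in> U"
    proof (rule ccontr)
      assume "v \<notin> U"
      then have "has_dim (Suc m) (adjoin U v)" using m has_dim.adjoin by blast
      then have "adjoin U v \<in> S" using adjoin_subset[OF assms] m v by (auto simp: S_def)
      then have "adjoin U v = U" using U subset_adjoin by metis
      moreover have "v \<in> adjoin U v"
        using adjoinI[of 0 U 1 v] subspace_overD(1)[OF has_dim_subspace[OF m(1)]] by simp
      ultimately show False using \<open>v \<notin> U\<close> by blast
    qed
  qed
  then show ?thesis using m by auto
qed

text \<open>Slice \<open>adjoin U v\<close> into lines in the direction \<open>v\<close>. On each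
  line \<open>f\<close> is a polynomial in \<open>t\<close>, and its coefficients are functions of
  lower degree on the flat \<open>a + U\<close>, to which induction applies.\<close>

lemma schwartz_zippel:
  assumes "has_dim m U" "poly_fun d f" "\<exists>u\<in>U. f (a + u) \<noteq> 0"
  shows "card K * card {u \<in> U. f (a + u) = 0} \<le> d * card U"
  using assms
proof (induction arbitrary: d f rule: has_dim.induct)
  case zero
  then have "{u \<in> {0}. f (a + u) = 0} = {}" by auto
  then show ?case by (metis card.empty mult_0_right zero_le)
next
  case (adjoin m U v)
  note U = has_dim_subspace[OF adjoin.hyps(1)]
  obtain c where c: "\<And>j. j \<le> d \<Longrightarrow> poly_fun (d - j) (c j)"
    and f: "\<And>x t. f (x + t *s v) = (\<Sum>j\<le>d. t ^ j * c j x)"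
    using poly_fun_line[OF adjoin.prems(1)] by metis
  define J where "J = {j. j \<le> d \<and> (\<exists>u\<in>U. c j (a + u) \<noteq> 0)}"
  have "J \<noteq> {}"
  proof
    assume "J = {}"
    then have "c j (a + u) = 0" if "u \<in> U" "j \<le> d" for j u using that by (auto simp: J_def)
    then have "f (a + u + t *s v) = 0" if "u \<in> U" for u t using that by (simp add: f)
    then show False using adjoin.prems(2) by (auto elim!: adjoinE simp: add.assoc)
  qed
  \<comment> \<open>\<open>k\<close> is the effective degree in \<open>t\<close> over
    \<open>a + U\<close>: the largest index whose coefficient does not vanish identically
    there.\<close>
  define k where "k = Max J"
  have "finite J" by (simp add: J_def)
  then have "k \<in> J" using \<open>J \<noteq> {}\<close> by (simp add: k_def)
  then have "k \<le> d" and kU: "\<exists>u\<in>U. c k (a + u) \<noteq> 0" by (auto simp: J_def)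
  have top: "c j (a + u) = 0" if "u \<in> U" "j \<le> d" "k < j" for j u
    using that Max_ge[OF \<open>finite J\<close>, of j] unfolding k_def[symmetric] by (auto simp: J_def)
  have fk: "f (a + u + t *s v) = (\<Sum>j\<le>k. t ^ j * c j (a + u))" if "u \<in> U" for u t
    unfolding f by (rule sum.mono_neutral_right) (use \<open>k \<le> d\<close> top[OF that] in auto)
  define B where "B = {u \<in> U. c k (a + u) = 0}"
  have B: "card K * card B \<le> (d - k) * card U"
    unfolding B_def by (rule adjoin.IH[OF c[OF \<open>k \<le> d\<close>] kU])
  have "card {x \<in> adjoin U v. f (a + x) = 0} = card {z \<in> U \<times> K. f (a + (fst z + snd z *s v)) = 0}"
    by (rule card_adjoin_filter[OF U \<open>v \<notin> U\<close>])
  also have "{z \<in> U \<times> K. f (a + (fst z + snd z *s v)) = 0}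
      = (SIGMA u:U. {t \<in> K. f (a + u + t *s v) = 0})" by (auto simp: add.assoc)
  also have "card \<dots> = (\<Sum>u\<in>U. card {t \<in> K. f (a + u + t *s v) = 0})" by simp
  \<comment> \<open>A line over \<open>B\<close> may consist of zeros only; every other line has a
    nonzero coefficient at index \<open>k\<close>, hence at most \<open>k\<close> zeros.\<close>
  also have "\<dots> \<le> (\<Sum>u\<in>U. (if u \<in> B then card K else 0) + k)"
  proof (rule sum_mono)
    fix u assume u: "u \<in> U"
    show "card {t \<in> K. f (a + u + t *s v) = 0} \<le> (if u \<in> B then card K else 0) + k"
    proof (cases "u \<in> B")
      case True
      then show ?thesis by (simp add: card_mono trans_le_add1)
    next
      case False
      then show ?thesis using card_roots_le[of "\<lambda>j. c j (a + u)" k K] u by (simp add: B_def fk)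
    qed
  qed
  also have "\<dots> = card B * card K + k * card U"
    by (simp add: sum.distrib sum.If_cases B_def Int_def)
  also have "\<dots> \<le> (d - k) * card U + k * card U" using B by (simp add: mult.commute)
  also have "\<dots> = d * card U" using \<open>k \<le> d\<close> by (simp add: add_mult_distrib[symmetric])
  finally show ?case using card_adjoin[OF U \<open>v \<notin> U\<close>] by (simp add: mult.commute mult.left_commute)
qed

end

text \<open>Subtracting \<open>b d\<close> times the monic product removes the coefficient of index
  \<open>d\<close>; a nonzero difference would have degree below \<open>d\<close> and
  \<open>d\<close> roots.\<close>

lemma poly_eq_prod_roots:
  fixes b :: "nat \<Rightarrow> 'a::field"
  assumes "finite T" "card T = d" "\<And>a. a \<in> T \<Longrightarrow> (\<Sum>j\<le>d. a ^ j * b j) = 0"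
  shows "(\<Sum>j\<le>d. t ^ j * b j) = b d * (\<Prod>a\<in>T. t - a)"
proof -
  define p where "p = (\<Sum>j\<le>d. monom (b j) j)"
  define q where "q = (\<Prod>a\<in>T. [:- a, 1:])"
  define r where "r = p - smult (b d) q"
  have p: "poly p t = (\<Sum>j\<le>d. t ^ j * b j)" for t
    by (simp add: p_def poly_sum poly_monom mult.commute)
  have q: "poly q t = (\<Prod>a\<in>T. t - a)" for t by (simp add: q_def poly_prod)
  have degq: "degree q = d" using assms by (simp add: q_def degree_prod_eq_sum_degree)
  have "lead_coeff q = 1" by (simp add: q_def lead_coeff_prod)
  moreover have "coeff p d = b d" by (simp add: p_def coeff_sum)
  ultimately have "coeff r d = 0" using degq by (simp add: r_def)
  have "degree p \<le> d" unfolding p_def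
    by (intro degree_sum_le) (auto intro: order.trans[OF degree_monom_le])
  then have "degree r \<le> d" using degq
    by (auto simp: r_def intro!: degree_diff_le order.trans[OF degree_smult_le])
  have "r = 0"
  proof (rule ccontr)
    assume "r \<noteq> 0"
    then have "degree r < d"
      using \<open>coeff r d = 0\<close> \<open>degree r \<le> d\<close> by (metis leading_coeff_0_iff order_le_less)
    moreover have "T \<subseteq> {x. poly r x = 0}"
      using assms(1,3) by (auto simp: r_def p q)
    then have "d \<le> card {x. poly r x = 0}"
      using card_mono poly_roots_finite[OF \<open>r \<noteq> 0\<close>] assms(2) by blast
    ultimately show False using card_poly_roots_bound[OF \<open>r \<noteq> 0\<close>] by linarith
  qed
  then have "poly p t = poly (smult (b d) q) t" by (simp add: r_def)
  then show ?thesis by (simp add: p q)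
qed

section \<open>Equality in the zero bound\<close>

context finite_subfield
begin

lemma adjoin_exchange:
  assumes "subspace_over W" "z \<in> adjoin W v" "z \<notin> W"
  shows "v \<in> adjoin W z"
proof -
  obtain u t where *: "u \<in> W" "t \<in> K" "z = u + t *s v" using assms adjoinE by metis
  then have "t \<noteq> 0" using assms by auto
  then have "v = - (inverse t *s u) + inverse t *s z"
    using * by (simp add: vec_eq_iff field_simps)
  then show ?thesis
    using * by (metis adjoinI assms(1) inverse_closed subspace_overD(3,4))
qed

lemma card_translate:
  assumes "subspace_over V" "a \<in> V"
  shows "card {z \<in> V. P (a + z)} = card {x \<in> V. P x}"
proof (rule bij_betw_same_card)
  show "bij_betw ((+) a) {z \<in> V. P (a + z)} {x \<in> V. P x}"
  proof (rule bij_betwI[where g = "\<lambda>x. x - a"])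
    show "(+) a \<in> {z \<in> V. P (a + z)} \<rightarrow> {x \<in> V. P x}"
      using assms by (auto intro: subspace_overD)
    show "(\<lambda>x. x - a) \<in> {x \<in> V. P x} \<rightarrow> {z \<in> V. P (a + z)}"
      using assms by (auto intro: subspace_overD)
  qed auto
qed

text \<open>Double counting around a maximal flat \<open>a + W\<close> of zeros. By maximality the
  zero bound applies to each flat of one dimension more, leaving at most
  \<open>(d - 1) * card W\<close> zeros off \<open>a + W\<close>; with so few in every direction,
  the extremal number of zeros is reached only if \<open>W\<close> has index \<open>card K\<close>
  in \<open>V\<close>.\<close>

lemma zero_set_contains_hyperplane:
  assumes V: "subspace_over V" and f: "poly_fun d f" "\<exists>x\<in>V. f x \<noteq> 0"
    and d: "1 \<le> d" "d < card K"
    and extremal: "card K * card {x \<in> V. f x = 0} = d * card V"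
  obtains m W a where "has_dim m W" "W \<subseteq> V" "a \<in> V" "\<forall>w\<in>W. f (a + w) = 0"
    "card V = card K * card W"
proof -
  \<comment> \<open>\<open>S\<close> collects the directions of all flats of zeros, whatever their
    base point. Hence no enlargement of a maximal \<open>W\<close> is a direction of zeros, in
    particular not at the base point \<open>a\<close>.\<close>
  define S where "S = {W. (\<exists>m. has_dim m W) \<and> W \<subseteq> V \<and> (\<exists>a\<in>V. \<forall>w\<in>W. f (a + w) = 0)}"
  have "0 \<in> V" by (rule subspace_overD(1)[OF V])
  then have "card V > 0" by (auto simp: card_gt_0_iff)
  then have "{x \<in> V. f x = 0} \<noteq> {}" using extremal d by (metis card.empty mult_is_0 not_one_le_zero less_irrefl)
  then have "{0} \<in> S" using \<open>0 \<in> V\<close> has_dim.zero by (auto simp: S_def)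
  then obtain W where W: "W \<in> S" "\<And>U. U \<in> S \<Longrightarrow> W \<subseteq> U \<Longrightarrow> U = W"
    using finite_has_maximal[of S] by (metis empty_iff finite)
  then obtain m a where m: "has_dim m W" "W \<subseteq> V" "a \<in> V" "\<forall>w\<in>W. f (a + w) = 0"
    by (auto simp: S_def)
  note sW = has_dim_subspace[OF m(1)]
  have "0 \<in> W" by (rule subspace_overD(1)[OF sW])
  then have Wpos: "card W > 0" by (auto simp: card_gt_0_iff)
  \<comment> \<open>After translation by \<open>- a\<close> the flat of zeros is \<open>W\<close>
    itself; \<open>Z\<close> holds the remaining zeros.\<close>
  define Z where "Z = {z \<in> V - W. f (a + z) = 0}"
  have "{z \<in> V. f (a + z) = 0} = Z \<union> W" using m by (auto simp: Z_def)
  then have "card {x \<in> V. f x = 0} = card (Z \<union> W)" using card_translate[OF V m(3), of "\<lambda>x. f x = 0"] by simp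
  also have "\<dots> = card Z + card W" by (rule card_Un_disjoint) (auto simp: Z_def)
  finally have cardZ: "card {x \<in> V. f x = 0} = card Z + card W" .
  have upper: "card {z \<in> Z. z \<in> adjoin W v} \<le> (d - 1) * card W" if v: "v \<in> V - W" for v
  proof -
    have "adjoin W v \<notin> S"
    proof
      assume "adjoin W v \<in> S"
      then have "adjoin W v = W" using W subset_adjoin by metis
      then show False using v adjoinI[of 0 W 1 v] \<open>0 \<in> W\<close> by simp
    qed
    moreover have "has_dim (Suc m) (adjoin W v)" using m v by (auto intro: has_dim.adjoin)
    moreover have "adjoin W v \<subseteq> V" using v m by (intro adjoin_subset[OF V]) auto
    ultimately have "\<exists>u\<in>adjoin W v. f (a + u) \<noteq> 0" using m by (auto simp: S_def)
    from schwartz_zippel[OF \<open>has_dim (Suc m) _\<close> f(1) this]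
    have "card K * card {u \<in> adjoin W v. f (a + u) = 0} \<le> card K * (d * card W)"
      using v by (simp add: card_adjoin[OF sW] mult_ac)
    then have *: "card {u \<in> adjoin W v. f (a + u) = 0} \<le> d * card W"
      using card_gt_1 by simp
    have "{u \<in> adjoin W v. f (a + u) = 0} = {z \<in> Z. z \<in> adjoin W v} \<union> W"
      using m subset_adjoin[of W v] \<open>adjoin W v \<subseteq> V\<close> by (auto simp: Z_def)
    also have "card \<dots> = card {z \<in> Z. z \<in> adjoin W v} + card W"
      by (rule card_Un_disjoint) (auto simp: Z_def)
    finally show ?thesis using * by (simp add: diff_mult_distrib)
  qed
  have fiber: "card {v \<in> V - W. z \<in> adjoin W v} = (card K - 1) * card W" if z: "z \<in> Z" for z
  proof -
    have "z \<in> V" "z \<notin> W" using z by (auto simp: Z_def)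
    have "{v \<in> V - W. z \<in> adjoin W v} = adjoin W z - W"
      using adjoin_exchange[OF sW] adjoin_subset[OF V m(2) \<open>z \<in> V\<close>] \<open>z \<notin> W\<close> by blast
    also have "card \<dots> = card W * card K - card W"
      using card_adjoin[OF sW \<open>z \<notin> W\<close>] subset_adjoin[of W z] by (simp add: card_Diff_subset)
    finally show ?thesis by (simp add: diff_mult_distrib mult.commute[of "card W"])
  qed
  \<comment> \<open>Count the pairs \<open>(v, z)\<close> with \<open>z\<close> in the flat spanned by \<open>W\<close> and \<open>v\<close>.\<close>
  have "card Z * ((card K - 1) * card W) = (\<Sum>z\<in>Z. (card K - 1) * card W)"
    by simp
  also have "\<dots> = (\<Sum>z\<in>Z. card {v \<in> V - W. z \<in> adjoin W v})"
    by (rule sum.cong[OF refl fiber[symmetric]])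
  also have "\<dots> = (\<Sum>v\<in>V - W. card {z \<in> Z. z \<in> adjoin W v})"
    by (rule sum_multicount_gen[symmetric]) auto
  also have "\<dots> \<le> (\<Sum>v\<in>V - W. (d - 1) * card W)" by (rule sum_mono) (rule upper)
  also have "\<dots> = ((card V - card W) * (d - 1)) * card W"
    using m by (simp add: card_Diff_subset)
  finally have "card Z * (card K - 1) \<le> (card V - card W) * (d - 1)" using Wpos by (simp flip: mult.assoc)
  moreover have VW: "card W \<le> card V" using m by (simp add: card_mono)
  \<comment> \<open>Integers avoid truncated subtraction. Inserting
    \<open>card K * card Z = d * card V - card K * card W\<close> leaves a common factor
    \<open>card K - d\<close>, which is positive.\<close>
  ultimately have "int (card Z * (card K - 1)) \<le> int ((card V - card W) * (d - 1))"
    using of_nat_le_iff by blast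
  then have "int (card Z) * (int (card K) - 1) \<le> (int (card V) - int (card W)) * (int d - 1)"
    using VW d by (simp add: of_nat_diff)
  then have "int (card K) * (int (card Z) * (int (card K) - 1))
      \<le> int (card K) * ((int (card V) - int (card W)) * (int d - 1))"
    by (rule mult_left_mono) simp
  moreover have ex: "int (card K) * int (card Z) = int d * int (card V) - int (card K) * int (card W)"
    using extremal unfolding cardZ by (simp add: algebra_simps flip: of_nat_mult of_nat_add)
  ultimately have "(int d * int (card V) - int (card K) * int (card W)) * (int (card K) - 1)
      \<le> int (card K) * ((int (card V) - int (card W)) * (int d - 1))"
    by (metis mult.assoc)
  then have "(int (card K) - int d) * int (card V) \<le> (int (card K) - int d) * (int (card K) * int (card W))"
    by (simp add: algebra_simps)
  then have "int (card V) \<le> int (card K) * int (card W)" using d by simp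
  then have le: "card V \<le> card K * card W" by (simp flip: of_nat_mult)
  \<comment> \<open>A vector of \<open>V\<close> outside \<open>W\<close> supplies the opposite
    inequality, since its adjunction to \<open>W\<close> still fits into \<open>V\<close>.\<close>
  have "\<not> V \<subseteq> W"
  proof
    assume "V \<subseteq> W"
    obtain x where "x \<in> V" "f x \<noteq> 0" using f by blast
    moreover then have "x - a \<in> W" using \<open>V \<subseteq> W\<close> subspace_overD(5)[OF V] m by blast
    then have "f (a + (x - a)) = 0" using m by blast
    ultimately show False by simp
  qed
  then obtain v where v: "v \<in> V" "v \<notin> W" by blast
  have "card (adjoin W v) \<le> card V" using adjoin_subset[OF V m(2) v(1)] by (simp add: card_mono)
  then have "card V = card K * card W" using le card_adjoin[OF sW v(2)] by (simp add: mult.commute)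
  with m that show thesis by blast
qed

text \<open>Cut \<open>V\<close> into the translates of the hyperplane \<open>W\<close> by
  \<open>t *s v\<close>. Counting zeros slice by slice shows that exactly \<open>d\<close> slices
  vanish, so in each direction line \<open>f\<close> has the same \<open>d\<close> roots. The
  leading coefficient has degree 0 and is therefore the same constant on all lines.\<close>

lemma extremal_product:
  assumes V: "subspace_over V" and f: "poly_fun d f" "\<exists>x\<in>V. f x \<noteq> 0"
    and d: "1 \<le> d" "d < card K"
    and extremal: "card K * card {x \<in> V. f x = 0} = d * card V"
  obtains W v T c where "subspace_over W" "v \<notin> W" "V = adjoin W v" "T \<subseteq> K" "card T = d" "c \<noteq> 0"
    "\<forall>w\<in>W. \<forall>t\<in>K. f (w + t *s v) = c * (\<Prod>\<alpha>\<in>T. t - \<alpha>)"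
proof -
  obtain m W a where W: "has_dim m W" "W \<subseteq> V" "a \<in> V" "\<forall>w\<in>W. f (a + w) = 0"
    and cardV: "card V = card K * card W"
    using zero_set_contains_hyperplane[OF assms] by metis
  note sW = has_dim_subspace[OF W(1)]
  have "0 \<in> W" by (rule subspace_overD(1)[OF sW])
  then have Wpos: "card W > 0" by (auto simp: card_gt_0_iff)
  have "V \<noteq> W" using cardV card_gt_1 Wpos by auto
  then obtain v where v: "v \<in> V" "v \<notin> W" using W by blast
  have Veq: "V = adjoin W v"
    using adjoin_subset[OF V W(2) v(1)] card_adjoin[OF sW v(2)] cardV
    by (metis card_subset_eq finite mult.commute)
  obtain c where c: "\<And>j. j \<le> d \<Longrightarrow> poly_fun (d - j) (c j)"
    and fc: "\<And>x t. f (x + t *s v) = (\<Sum>j\<le>d. t ^ j * c j x)"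
    using poly_fun_line[OF f(1)] by metis
  define T where "T = {t \<in> K. \<forall>w\<in>W. f (w + t *s v) = 0}"
  define k where "k = card T"
  have TK: "T \<subseteq> K" by (auto simp: T_def)
  \<comment> \<open>The flat \<open>a + W\<close> is the slice at \<open>t0\<close>, so at least one
    slice vanishes and \<open>k\<close> is positive.\<close>
  obtain w0 t0 where a: "w0 \<in> W" "t0 \<in> K" "a = w0 + t0 *s v" using W(3) Veq adjoinE by metis
  have "t0 \<in> T"
  proof -
    have "f (w + t0 *s v) = 0" if "w \<in> W" for w
    proof -
      have "w + t0 *s v = a + (w - w0)" using a by (simp add: algebra_simps)
      then show ?thesis using W(4) subspace_overD(5)[OF sW that a(1)] by metis
    qed
    then show ?thesis using a by (simp add: T_def)
  qed
  then have "0 < k" by (auto simp: k_def card_gt_0_iff)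
  have "T \<noteq> K" using f(2) Veq by (auto simp: T_def elim!: adjoinE)
  \<comment> \<open>Subtracting the interpolation at the zero slices \<open>T\<close> cancels the coefficients of index below \<open>k\<close>, so \<open>f\<close>
    has degree at most \<open>d - k\<close> on every other slice.\<close>
  have slice: "k \<le> d \<and> card K * card {w \<in> W. f (w + x *s v) = 0} \<le> (d - k) * card W"
    if x: "x \<in> K - T" for x
  proof -
    obtain l where l: "\<And>j. j < k \<Longrightarrow> (\<Sum>\<alpha>\<in>T. l \<alpha> * \<alpha> ^ j) = x ^ j"
      using lagrange_weights[of T x] by (auto simp: k_def)
    define e where "e j = x ^ j - (\<Sum>\<alpha>\<in>T. l \<alpha> * \<alpha> ^ j)" for j
    have low: "e j = 0" if "j < k" for j using l that by (simp add: e_def)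
    define h where "h y = (\<Sum>j\<in>{k..d}. e j * c j y)" for y
    have h: "f (w + x *s v) = h w" if "w \<in> W" for w
    proof -
      have "f (w + x *s v) = f (w + x *s v) - (\<Sum>\<alpha>\<in>T. l \<alpha> * f (w + \<alpha> *s v))"
        using that by (simp add: T_def)
      also have "(\<Sum>\<alpha>\<in>T. l \<alpha> * f (w + \<alpha> *s v)) = (\<Sum>j\<le>d. \<Sum>\<alpha>\<in>T. l \<alpha> * \<alpha> ^ j * c j w)"
        unfolding fc sum_distrib_left by (subst sum.swap) (simp add: mult.assoc)
      also have "f (w + x *s v) - \<dots> = (\<Sum>j\<le>d. e j * c j w)"
        by (simp add: fc e_def sum_subtractf left_diff_distrib sum_distrib_right)
      also have "\<dots> = h w"
        unfolding h_def by (rule sum.mono_neutral_right) (use low in force)+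
      finally show ?thesis .
    qed
    obtain w where w: "w \<in> W" "f (w + x *s v) \<noteq> 0" using x by (auto simp: T_def)
    \<comment> \<open>For \<open>k > d\<close> the sum defining \<open>h\<close> is empty,
      contradicting the nonzero value at \<open>w\<close>.\<close>
    have "k \<le> d"
    proof (rule ccontr)
      assume "\<not> k \<le> d"
      then show False using w h by (simp add: h_def)
    qed
    have "poly_fun (d - k) (\<lambda>y. \<Sum>j\<in>{k..d}. e j * c j y)"
      by (intro poly_fun_sum poly_fun_cmult poly_fun_mono[OF c]) auto
    then have "poly_fun (d - k) h" by (simp add: h_def[abs_def])
    then have "card K * card {w \<in> W. h (0 + w) = 0} \<le> (d - k) * card W"
      by (rule schwartz_zippel[OF W(1)]) (use w h in auto)
    moreover have "{w \<in> W. h (0 + w) = 0} = {w \<in> W. f (w + x *s v) = 0}" using h by auto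
    ultimately show ?thesis using \<open>k \<le> d\<close> by simp
  qed
  have "k \<le> d" using \<open>T \<noteq> K\<close> TK slice by blast
  have "{z \<in> W \<times> K. f (fst z + snd z *s v) = 0} = (\<lambda>(t, w). (w, t)) ` (SIGMA t:K. {w \<in> W. f (w + t *s v) = 0})"
    by force
  then have "card {x \<in> V. f x = 0} = card (SIGMA t:K. {w \<in> W. f (w + t *s v) = 0})"
    unfolding Veq card_adjoin_filter[OF sW v(2)] by (simp add: card_image inj_on_def split_beta prod_eq_iff)
  also have "\<dots> = (\<Sum>t\<in>K. card {w \<in> W. f (w + t *s v) = 0})" by simp
  finally have "d * card V = (\<Sum>t\<in>K. card K * card {w \<in> W. f (w + t *s v) = 0})"
    using extremal by (simp add: sum_distrib_left)
  also have "\<dots> \<le> (\<Sum>t\<in>K. if t \<in> T then card K * card W else (d - k) * card W)"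
    using slice by (intro sum_mono) (auto intro: card_mono)
  also have "\<dots> = k * (card K * card W) + (card K - k) * ((d - k) * card W)"
    using TK by (simp add: sum.If_cases k_def Int_absorb1 card_Diff_subset Diff_eq[symmetric])
  finally have "(d * card K) * card W \<le> (k * card K + (card K - k) * (d - k)) * card W"
    by (simp add: cardV algebra_simps)
  then have main: "d * card K \<le> k * card K + (card K - k) * (d - k)" using Wpos by simp
  \<comment> \<open>With \<open>d = k + q\<close> and \<open>card K = k + p\<close> the inequality
    \<open>main\<close> collapses to \<open>k * q \<le> 0\<close>.\<close>
  have "k = d"
  proof -
    obtain q where q: "d = k + q" using \<open>k \<le> d\<close> le_Suc_ex by blast
    obtain p where p: "card K = k + p" using \<open>k \<le> d\<close> d le_Suc_ex by (metis less_imp_le order.trans)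
    have "k * q \<le> 0" using main unfolding q p by (simp add: algebra_simps)
    then show ?thesis using q \<open>0 < k\<close> by simp
  qed
  have "poly_fun 0 (c d)" using c[of d] by simp
  then obtain C where C: "c d = (\<lambda>x. C)" using poly_fun_0 by blast
  have form: "f (w + t *s v) = C * (\<Prod>\<alpha>\<in>T. t - \<alpha>)" if "w \<in> W" for w t
    unfolding fc using poly_eq_prod_roots[of T d "\<lambda>j. c j w" t] that \<open>k = d\<close>
    by (simp add: T_def k_def fc C)
  moreover have "C \<noteq> 0" using f(2) Veq form by (auto elim!: adjoinE)
  ultimately show thesis using that[OF sW v(2) Veq TK] \<open>k = d\<close> by (simp add: k_def)
qed

text \<open>The form \<open>L\<close> reads off the coordinate along \<open>v\<close> in the
  splitting of \<open>V\<close> by \<open>W\<close> and \<open>v\<close>, so that the product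
  formula mentions neither of them.\<close>

lemma extremal_linear_form:
  assumes V: "subspace_over V" and f: "poly_fun d f" "\<exists>x\<in>V. f x \<noteq> 0"
    and d: "1 \<le> d" "d < card K"
    and extremal: "card K * card {x \<in> V. f x = 0} = d * card V"
  obtains L T c where "T \<subseteq> K" "card T = d" "c \<noteq> 0"
    "\<And>x. x \<in> V \<Longrightarrow> L x \<in> K" "\<And>x y. x \<in> V \<Longrightarrow> y \<in> V \<Longrightarrow> L (x + y) = L x + L y"
    "\<And>t x. t \<in> K \<Longrightarrow> x \<in> V \<Longrightarrow> L (t *s x) = t * L x" "\<exists>x\<in>V. L x \<noteq> 0"
    "\<And>x. x \<in> V \<Longrightarrow> f x = c * (\<Prod>\<alpha>\<in>T. L x - \<alpha>)"
proof -
  obtain W v T c where W: "subspace_over W" "v \<notin> W" and V': "V = adjoin W v"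
    and T: "T \<subseteq> K" "card T = d" "c \<noteq> 0"
    and form: "\<forall>w\<in>W. \<forall>t\<in>K. f (w + t *s v) = c * (\<Prod>\<alpha>\<in>T. t - \<alpha>)"
    using extremal_product[OF assms] by metis
  define L where "L x = (THE t. t \<in> K \<and> (\<exists>w\<in>W. x = w + t *s v))" for x
  have L: "L (w + t *s v) = t" if "w \<in> W" "t \<in> K" for w t
    unfolding L_def using that adjoin_coords_unique[OF W] by (intro the_equality) blast+
  show thesis
  proof (rule that[OF T])
    fix x assume "x \<in> V"
    then obtain w t where x: "w \<in> W" "t \<in> K" "x = w + t *s v" using V' adjoinE by metis
    then show "L x \<in> K" "f x = c * (\<Prod>\<alpha>\<in>T. L x - \<alpha>)" using L form by auto
    { fix r assume "r \<in> K"
      have "r *s x = r *s w + (r * t) *s v"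
        using x by (simp add: vector_add_ldistrib vector_smult_assoc)
      then show "L (r *s x) = r * L x"
        using x L \<open>r \<in> K\<close> by (simp add: mult_closed subspace_overD(3)[OF W(1)]) }
    fix y assume "y \<in> V"
    then obtain w' t' where y: "w' \<in> W" "t' \<in> K" "y = w' + t' *s v" using V' adjoinE by metis
    have "x + y = (w + w') + (t + t') *s v"
      using x y by (simp add: vector_sadd_rdistrib algebra_simps)
    then show "L (x + y) = L x + L y"
      using L[OF subspace_overD(2)[OF W(1) x(1) y(1)] add_closed[OF x(2) y(2)]] L x y by metis
  next
    show "\<exists>x\<in>V. L x \<noteq> 0"
      using L[of 0 1] adjoinI[of 0 W 1 v] V' subspace_overD(1)[OF W(1)] by force
  qed
qed

end

subsection \<open>Reduced polynomials\<close>

text \<open>On a finite index type every function has finite support, so this inverts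
  \<open>lookup\<close> and sums over exponents can range over plain functions.\<close>

definition exponent :: "('n::finite \<Rightarrow> nat) \<Rightarrow> ('n \<Rightarrow>\<^sub>0 nat)" where
  "exponent \<phi> = Abs_poly_mapping \<phi>"

lemma lookup_exponent [simp]: "Poly_Mapping.lookup (exponent \<phi>) = \<phi>"
  by (simp add: exponent_def)

lemma exponent_lookup [simp]: "exponent (Poly_Mapping.lookup m) = m"
  by (simp add: exponent_def)

lemma mpol_eval_exponents:
  assumes "finite S" "Poly_Mapping.lookup ` Poly_Mapping.keys P \<subseteq> S"
  shows "mpol_eval P x = (\<Sum>\<phi>\<in>S. Poly_Mapping.lookup P (exponent \<phi>) * (\<Prod>i\<in>UNIV. (x $ i) ^ \<phi> i))"
proof -
  have "inj_on exponent S" by (metis inj_onI lookup_exponent)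
  moreover have "Poly_Mapping.keys P \<subseteq> exponent ` S"
    using assms(2) by (metis exponent_lookup image_eqI image_subset_iff subsetI)
  then have "mpol_eval P x = (\<Sum>m\<in>exponent ` S. Poly_Mapping.lookup P m * (\<Prod>i\<in>UNIV. (x $ i) ^ Poly_Mapping.lookup m i))"
    unfolding mpol_eval_def using assms(1)
    by (intro sum.mono_neutral_left) (auto simp: in_keys_iff)
  ultimately show ?thesis by (simp add: sum.reindex)
qed

lemma mpol_of_coeffs:
  fixes c :: "('n::finite \<Rightarrow> nat) \<Rightarrow> 'a::comm_semiring_1"
  assumes "finite S"
  obtains P where "Poly_Mapping.lookup ` Poly_Mapping.keys P \<subseteq> S"
    "\<And>x. mpol_eval P x = (\<Sum>\<phi>\<in>S. c \<phi> * (\<Prod>i\<in>UNIV. (x $ i) ^ \<phi> i))"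
proof -
  define g where "g m = (if Poly_Mapping.lookup m \<in> S then c (Poly_Mapping.lookup m) else 0)" for m
  have "{m. g m \<noteq> 0} \<subseteq> exponent ` S"
    by (auto simp: g_def) (metis exponent_lookup image_eqI)
  then have "finite {m. g m \<noteq> 0}" using assms finite_subset by blast
  then have g: "Poly_Mapping.lookup (Abs_poly_mapping g) = g" by simp
  then have "Poly_Mapping.lookup ` Poly_Mapping.keys (Abs_poly_mapping g) \<subseteq> S"
    by (auto simp: in_keys_iff g_def split: if_splits)
  moreover from mpol_eval_exponents[OF assms this]
  have "mpol_eval (Abs_poly_mapping g) x = (\<Sum>\<phi>\<in>S. c \<phi> * (\<Prod>i\<in>UNIV. (x $ i) ^ \<phi> i))" for x
    by (simp add: g g_def)
  ultimately show thesis by (rule that)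
qed

lemma mpol_degree_in_less_iff:
  "mpol_degree_in i P < k \<longleftrightarrow> 0 < k \<and> (\<forall>m\<in>Poly_Mapping.keys P. Poly_Mapping.lookup m i < k)"
  by (auto simp: mpol_degree_in_def)

lemma mpol_total_degree_le_iff:
  "mpol_total_degree P \<le> k \<longleftrightarrow> (\<forall>m\<in>Poly_Mapping.keys P. (\<Sum>i\<in>UNIV. Poly_Mapping.lookup m i) \<le> k)"
  by (auto simp: mpol_total_degree_def)

section \<open>Interpolation on X and uniqueness of reduced polynomials\<close>

lemma card_cart_prod: "card (cart_prod K) = (\<Prod>i\<in>UNIV. card (K i))"
proof -
  have "bij_betw vec_nth (cart_prod K) (PiE UNIV K)"
    by (rule bij_betwI[where g = vec_lambda]) (auto simp: cart_prod_def PiE_def)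
  then show ?thesis by (simp add: bij_betw_same_card card_PiE)
qed

lemma card_cart_prod_update:
  "card (cart_prod (K(i := T))) * card (K i) = card T * card (cart_prod K)"
proof -
  have "(\<Prod>j\<in>UNIV - {i}. card ((K(i := T)) j)) = (\<Prod>j\<in>UNIV - {i}. card (K j))"
    by (rule prod.cong) auto
  then show ?thesis
    by (simp add: card_cart_prod prod.remove[of UNIV i])
qed

text \<open>The Lagrange basis polynomial of \<open>A\<close> at \<open>a\<close>; its degree is
  \<open>card A - 1\<close>.\<close>

lemma univariate_delta:
  fixes A :: "'a::{field,finite} set"
  assumes "a \<in> A"
  shows "\<exists>b. \<forall>t\<in>A. (\<Sum>j<card A. b j * t ^ j) = (if t = a then 1 else 0)"
proof -
  define p where "p = smult (inverse (\<Prod>\<beta>\<in>A - {a}. a - \<beta>)) (\<Prod>\<beta>\<in>A - {a}. [:- \<beta>, 1:])"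
  have p: "poly p t = inverse (\<Prod>\<beta>\<in>A - {a}. a - \<beta>) * (\<Prod>\<beta>\<in>A - {a}. t - \<beta>)" for t
    by (simp add: p_def poly_prod)
  have "degree p \<le> card A - 1" unfolding p_def
    by (rule order.trans[OF degree_smult_le]) (use assms in \<open>simp add: degree_prod_eq_sum_degree\<close>)
  moreover have "0 < card A" using assms by (auto simp: card_gt_0_iff)
  ultimately have "degree p < card A" by linarith
  then have "poly p t = (\<Sum>j<card A. coeff p j * t ^ j)" for t
    unfolding poly_altdef by (intro sum.mono_neutral_left) (auto simp: coeff_eq_0)
  moreover have "poly p t = (if t = a then 1 else 0)" if "t \<in> A" for t
    unfolding p using that by auto
  ultimately show ?thesis by (intro exI[of _ "coeff p"]) auto
qed

definition exponent_box :: "('n \<Rightarrow> 'a set) \<Rightarrow> ('n \<Rightarrow> nat) set" where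
  "exponent_box K = PiE UNIV (\<lambda>i. {..<card (K i)})"

lemma exponent_box_iff: "\<phi> \<in> exponent_box K \<longleftrightarrow> (\<forall>i. \<phi> i < card (K i))"
  by (auto simp: exponent_box_def)

lemma finite_exponent_box [simp]: "finite (exponent_box (K :: 'n::finite \<Rightarrow> 'a set))"
  by (simp add: exponent_box_def finite_PiE)

lemma card_exponent_box: "card (exponent_box (K :: 'n::finite \<Rightarrow> 'a set)) = (\<Prod>i\<in>UNIV. card (K i))"
  by (simp add: exponent_box_def card_PiE)

definition box_eval :: "('n::finite \<Rightarrow> 'a::field set) \<Rightarrow> (('n \<Rightarrow> nat) \<Rightarrow> 'a) \<Rightarrow> 'a ^ 'n \<Rightarrow> 'a" where
  "box_eval K c x = (\<Sum>\<phi>\<in>exponent_box K. c \<phi> * (\<Prod>i\<in>UNIV. (x $ i) ^ \<phi> i))"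

text \<open>A product of univariate delta polynomials, one per coordinate, is the indicator of a
  point. Expanding it gives only exponents of the box, and every function on X is a combination of
  such indicators.\<close>

lemma box_eval_surj:
  fixes K :: "'n::finite \<Rightarrow> 'a::{field,finite} set"
  shows "\<exists>c. \<forall>x\<in>cart_prod K. g x = box_eval K c x"
proof -
  have "\<exists>b. \<forall>t\<in>K i. (\<Sum>j<card (K i). b j * t ^ j) = (if t = a $ i then 1 else 0)"
    if "a \<in> cart_prod K" for a i
    using that by (intro univariate_delta) (auto simp: cart_prod_def)
  then obtain b where b: "\<And>a i t. a \<in> cart_prod K \<Longrightarrow> t \<in> K i \<Longrightarrow>
      (\<Sum>j<card (K i). b a i j * t ^ j) = (if t = a $ i then 1 else 0)"
    by metis
  define c where "c \<phi> = (\<Sum>a\<in>cart_prod K. g a * (\<Prod>i\<in>UNIV. b a i (\<phi> i)))" for \<phi>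
  have "box_eval K c x = g x" if x: "x \<in> cart_prod K" for x
  proof -
    have "box_eval K c x = (\<Sum>a\<in>cart_prod K. g a *
        (\<Sum>\<phi>\<in>exponent_box K. \<Prod>i\<in>UNIV. b a i (\<phi> i) * (x $ i) ^ \<phi> i))"
      unfolding box_eval_def c_def sum_distrib_left sum_distrib_right
      by (subst sum.swap) (simp add: prod.distrib mult.assoc)
    also have "\<dots> = (\<Sum>a\<in>cart_prod K. g a * (\<Prod>i\<in>UNIV. \<Sum>j<card (K i). b a i j * (x $ i) ^ j))"
      by (simp add: exponent_box_def prod_sum_PiE)
    also have "\<dots> = (\<Sum>a\<in>cart_prod K. g a * (if x = a then 1 else 0))"
    proof (rule sum.cong[OF refl])
      fix a assume a: "a \<in> cart_prod K"
      have "(\<Prod>i\<in>UNIV. \<Sum>j<card (K i). b a i j * (x $ i) ^ j) = (\<Prod>i\<in>UNIV. if x $ i = a $ i then 1 else 0)"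
        using x by (intro prod.cong refl b a) (auto simp: cart_prod_def)
      also have "\<dots> = (if x = a then 1 else 0)" by (auto simp: vec_eq_iff prod_zero_iff)
      finally show "g a * (\<Prod>i\<in>UNIV. \<Sum>j<card (K i). b a i j * (x $ i) ^ j) = g a * (if x = a then 1 else 0)"
        by simp
    qed
    also have "\<dots> = g x" using x by (simp add: if_distrib cong: if_cong)
    finally show ?thesis .
  qed
  then show ?thesis by metis
qed

text \<open>Surjectivity of evaluation forces injectivity, since there are as many exponents as points.\<close>

lemma box_eval_inj:
  fixes K :: "'n::finite \<Rightarrow> 'a::{field,finite} set"
  assumes "\<forall>x\<in>cart_prod K. box_eval K c x = box_eval K c' x" "\<phi> \<in> exponent_box K"
  shows "c \<phi> = c' \<phi>"
proof -
  let ?C = "exponent_box K \<rightarrow>\<^sub>E (UNIV :: 'a set)"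
  let ?ev = "\<lambda>c. restrict (box_eval K c) (cart_prod K)"
  have eval_restrict: "box_eval K (restrict c (exponent_box K)) = box_eval K c" for c
    by (simp add: box_eval_def fun_eq_iff)
  have "cart_prod K \<rightarrow>\<^sub>E UNIV \<subseteq> ?ev ` ?C"
  proof
    fix g :: "'a ^ 'n \<Rightarrow> 'a" assume g: "g \<in> cart_prod K \<rightarrow>\<^sub>E UNIV"
    obtain c where "\<forall>x\<in>cart_prod K. g x = box_eval K c x" using box_eval_surj[of K g] by metis
    then have "g = ?ev (restrict c (exponent_box K))"
      using g by (auto simp: eval_restrict PiE_def extensional_def fun_eq_iff)
    then show "g \<in> ?ev ` ?C" by (rule image_eqI[where x = "restrict c (exponent_box K)"]) auto
  qed
  then have "?ev ` ?C = cart_prod K \<rightarrow>\<^sub>E UNIV" by auto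
  moreover have "card (cart_prod K \<rightarrow>\<^sub>E (UNIV :: 'a set)) = card ?C"
    by (simp add: card_PiE card_cart_prod card_exponent_box)
  moreover have "finite ?C" by (simp add: finite_PiE)
  ultimately have inj: "inj_on ?ev ?C" by (simp add: eq_card_imp_inj_on)
  have "?ev (restrict c (exponent_box K)) = ?ev (restrict c' (exponent_box K))"
    unfolding eval_restrict by (rule restrict_ext) (use assms(1) in blast)
  then have "restrict c (exponent_box K) = restrict c' (exponent_box K)"
    using inj_on_eq_iff[OF inj, of "restrict c (exponent_box K)" "restrict c' (exponent_box K)"]
    by simp
  then show ?thesis using assms(2) by (metis restrict_apply')
qed

definition is_reduced_poly ::
    "('n::finite \<Rightarrow> 'a::{field,finite} set) \<Rightarrow> ('a ^ 'n \<Rightarrow> 'a) \<Rightarrow> ('n, 'a) mpol \<Rightarrow> bool" where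
  "is_reduced_poly K f P \<longleftrightarrow> (\<forall>i. mpol_degree_in i P < card (K i)) \<and> (\<forall>x\<in>cart_prod K. f x = mpol_eval P x)"

lemma degree_in_less_imp_exponent_box:
  "\<forall>i. mpol_degree_in i P < card (K i) \<Longrightarrow> Poly_Mapping.lookup ` Poly_Mapping.keys P \<subseteq> exponent_box K"
  by (auto simp: mpol_degree_in_less_iff exponent_box_iff)

lemma ex1_reduced_poly:
  fixes K :: "'n::finite \<Rightarrow> 'a::{field,finite} set"
  assumes "\<And>i. K i \<noteq> {}"
  shows "\<exists>!P. is_reduced_poly K f P"
proof (rule ex_ex1I)
  obtain c where c: "\<forall>x\<in>cart_prod K. f x = box_eval K c x" using box_eval_surj by blast
  obtain P where P: "Poly_Mapping.lookup ` Poly_Mapping.keys P \<subseteq> exponent_box K"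
    "\<And>x. mpol_eval P x = (\<Sum>\<phi>\<in>exponent_box K. c \<phi> * (\<Prod>i\<in>UNIV. (x $ i) ^ \<phi> i))"
    using mpol_of_coeffs[OF finite_exponent_box] by blast
  \<comment> \<open>The zero polynomial has degree 0, so even there the strict degree bound asks for
    a nonempty \<open>K i\<close>.\<close>
  have "card (K i) > 0" for i using assms by (simp add: card_gt_0_iff)
  then have "is_reduced_poly K f P"
    using P c by (auto simp: is_reduced_poly_def mpol_degree_in_less_iff box_eval_def exponent_box_iff)
  then show "\<exists>P. is_reduced_poly K f P" by blast
next
  fix P Q assume PQ: "is_reduced_poly K f P" "is_reduced_poly K f Q"
  have supp: "Poly_Mapping.lookup ` Poly_Mapping.keys P \<subseteq> exponent_box K"
    "Poly_Mapping.lookup ` Poly_Mapping.keys Q \<subseteq> exponent_box K"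
    using PQ degree_in_less_imp_exponent_box by (auto simp: is_reduced_poly_def)
  have "\<forall>x\<in>cart_prod K. box_eval K (\<lambda>\<phi>. Poly_Mapping.lookup P (exponent \<phi>)) x =
      box_eval K (\<lambda>\<phi>. Poly_Mapping.lookup Q (exponent \<phi>)) x"
    using PQ mpol_eval_exponents[OF finite_exponent_box supp(1)] mpol_eval_exponents[OF finite_exponent_box supp(2)]
    by (simp add: is_reduced_poly_def box_eval_def)
  then have "Poly_Mapping.lookup P (exponent \<phi>) = Poly_Mapping.lookup Q (exponent \<phi>)" if "\<phi> \<in> exponent_box K" for \<phi>
    by (rule box_eval_inj[OF _ that])
  moreover have "Poly_Mapping.lookup P m = 0 \<and> Poly_Mapping.lookup Q m = 0" if "Poly_Mapping.lookup m \<notin> exponent_box K" for m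
    using that supp by (auto simp: in_keys_iff image_subset_iff)
  ultimately show "P = Q"
    by (intro poly_mapping_eqI) (metis (no_types) exponent_lookup)
qed

section \<open>Codewords as polynomial functions and the minimum weight\<close>

lemma reduced_poly_eq_The: "reduced_poly K f = (THE P. is_reduced_poly K f P)"
  by (simp add: reduced_poly_def is_reduced_poly_def)

lemma poly_fun_of_code:
  fixes K :: "'n::finite \<Rightarrow> 'a::{field,finite} set"
  assumes "\<And>i. K i \<noteq> {}" "f \<in> code K d" "f \<noteq> zero_fun K"
  obtains p where "poly_fun d p" "\<And>x. x \<in> cart_prod K \<Longrightarrow> f x = p x"
proof -
  have red: "is_reduced_poly K f (reduced_poly K f)"
    using theI'[OF ex1_reduced_poly[of K f, OF assms(1)]] by (simp only: reduced_poly_eq_The)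
  have deg: "mpol_total_degree (reduced_poly K f) \<le> d"
    using assms by (auto simp: code_def fun_degree_def)
  have "poly_fun d (\<lambda>x. \<Sum>m\<in>Poly_Mapping.keys (reduced_poly K f).
      Poly_Mapping.lookup (reduced_poly K f) m * (\<Prod>i\<in>UNIV. (x $ i) ^ Poly_Mapping.lookup m i))"
    by (intro poly_fun_sum poly_fun_cmult poly_fun_mono[OF poly_fun_monomial])
      (use deg in \<open>simp add: mpol_total_degree_le_iff\<close>)
  then have "poly_fun d (mpol_eval (reduced_poly K f))"
    by (simp add: mpol_eval_def[abs_def])
  then show thesis using red that by (auto simp: is_reduced_poly_def)
qed

text \<open>The product has degree \<open>card T < card (K i)\<close> in the variable
  \<open>i\<close> and 0 in the others. Its expansion is thus already reduced, and by uniqueness it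
  is the reduced polynomial.\<close>

lemma prod_roots_in_code:
  fixes K :: "'n::finite \<Rightarrow> 'a::{field,finite} set"
  assumes "\<And>i. K i \<noteq> {}" "card T < card (K i)"
  shows "(\<lambda>x\<in>cart_prod K. \<Prod>\<alpha>\<in>T. x $ i - \<alpha>) \<in> code K (card T)"
proof -
  define p where "p = (\<Prod>\<alpha>\<in>T. [:- \<alpha>, 1:])"
  \<comment> \<open>\<open>e j\<close> is the exponent vector of the \<open>j\<close>-th power of
    the variable \<open>i\<close>.\<close>
  define e where "e j = (\<lambda>k. if k = i then j else 0)" for j :: nat
  have p: "poly p t = (\<Prod>\<alpha>\<in>T. t - \<alpha>)" for t by (simp add: p_def poly_prod)
  have "degree p = card T" by (simp add: p_def degree_prod_eq_sum_degree)
  obtain P where P: "Poly_Mapping.lookup ` Poly_Mapping.keys P \<subseteq> e ` {..card T}"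
    "\<And>x. mpol_eval P x = (\<Sum>\<phi>\<in>e ` {..card T}. coeff p (\<phi> i) * (\<Prod>k\<in>UNIV. (x $ k) ^ \<phi> k))"
    using mpol_of_coeffs[of "e ` {..card T}" "\<lambda>\<phi>. coeff p (\<phi> i)"] by auto
  have "inj e" by (auto simp: inj_def e_def fun_eq_iff split: if_splits)
  have "mpol_eval P x = (\<Prod>\<alpha>\<in>T. x $ i - \<alpha>)" for x
  proof -
    have "(\<Prod>k\<in>UNIV. (x $ k) ^ e j k) = (x $ i) ^ j" for j
      by (subst prod.remove[of _ i]) (auto simp: e_def)
    then have "mpol_eval P x = (\<Sum>j\<le>card T. coeff p j * (x $ i) ^ j)"
      unfolding P(2) by (subst sum.reindex) (use \<open>inj e\<close> in \<open>auto simp: e_def inj_on_def inj_def\<close>)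
    then show ?thesis using \<open>degree p = card T\<close> p by (metis poly_altdef)
  qed
  moreover have "mpol_degree_in k P < card (K k)" for k
  proof -
    have "Poly_Mapping.lookup m k < card (K k)" if "m \<in> Poly_Mapping.keys P" for m
    proof -
      have "Poly_Mapping.lookup m \<in> e ` {..card T}" using P(1) that by blast
      then obtain j where "j \<le> card T" "Poly_Mapping.lookup m = e j" by blast
      then show ?thesis using assms by (auto simp: e_def card_gt_0_iff)
    qed
    then show ?thesis using assms(1) by (auto simp: mpol_degree_in_less_iff card_gt_0_iff)
  qed
  ultimately have "is_reduced_poly K (\<lambda>x\<in>cart_prod K. \<Prod>\<alpha>\<in>T. x $ i - \<alpha>) P"
    by (simp add: is_reduced_poly_def)
  then have "reduced_poly K (\<lambda>x\<in>cart_prod K. \<Prod>\<alpha>\<in>T. x $ i - \<alpha>) = P"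
    using the1_equality[OF ex1_reduced_poly[OF assms(1)]] by (simp only: reduced_poly_eq_The)
  moreover have "mpol_total_degree P \<le> card T"
    unfolding mpol_total_degree_le_iff
  proof
    fix m assume "m \<in> Poly_Mapping.keys P"
    then have "Poly_Mapping.lookup m \<in> e ` {..card T}" using P(1) by blast
    then obtain j where "j \<le> card T" "Poly_Mapping.lookup m = e j" by blast
    then show "(\<Sum>k\<in>UNIV. Poly_Mapping.lookup m k) \<le> card T" by (simp add: e_def)
  qed
  ultimately show ?thesis by (simp add: code_def fun_degree_def code_algebra_def)
qed

text \<open>The product over \<open>d\<close> elements of \<open>K i\<close> vanishes on the
  proportion \<open>d / card (K i)\<close> of X. The resulting bound on the minimum weight is stated
  without division or subtraction.\<close>

lemma min_weight_le_example:
  fixes K :: "'n::finite \<Rightarrow> 'a::{field,finite} set"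
  assumes "\<And>i. K i \<noteq> {}" "d < card (K i)"
  shows "card (K i) * min_weight K d + d * card (cart_prod K) \<le> card (K i) * card (cart_prod K)"
proof -
  obtain T where T: "T \<subseteq> K i" "card T = d"
    using assms(2) obtain_subset_with_card_n by (metis less_imp_le)
  define g where "g = (\<lambda>x\<in>cart_prod K. \<Prod>\<alpha>\<in>T. x $ i - \<alpha>)"
  have g: "g \<in> code K d" unfolding g_def using prod_roots_in_code[of K T i] assms T by simp
  have zeros: "{x \<in> cart_prod K. g x = 0} = cart_prod (K(i := T))"
    using T by (auto simp: g_def cart_prod_def split: if_splits)
  have count: "card (K i) * card (cart_prod (K(i := T))) = d * card (cart_prod K)"
    using card_cart_prod_update[of K i T] T by (simp add: mult.commute)
  have "(\<chi> j. SOME a. a \<in> K j) \<in> cart_prod K"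
    using assms(1) by (auto simp: cart_prod_def some_in_eq)
  then have Xpos: "card (cart_prod K) > 0" by (auto simp: card_gt_0_iff)
  have "g \<noteq> zero_fun K"
  proof
    assume "g = zero_fun K"
    then have "{x \<in> cart_prod K. g x = 0} = cart_prod K" by (auto simp: zero_fun_def)
    then show False using zeros count Xpos assms(2) by simp
  qed
  have "finite (code K d)"
    by (rule finite_subset[of _ "insert (zero_fun K) (cart_prod K \<rightarrow>\<^sub>E UNIV)"])
      (auto simp: code_def code_algebra_def finite_PiE)
  then have "min_weight K d \<le> weight K g"
    unfolding min_weight_def using g \<open>g \<noteq> zero_fun K\<close> by (intro Min_le) auto
  moreover have "weight K g + card {x \<in> cart_prod K. g x = 0} = card (cart_prod K)"
  proof -
    have "weight K g + card {x \<in> cart_prod K. g x = 0} =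
        card ({x \<in> cart_prod K. g x \<noteq> 0} \<union> {x \<in> cart_prod K. g x = 0})"
      unfolding weight_def by (rule card_Un_disjoint[symmetric]) auto
    also have "{x \<in> cart_prod K. g x \<noteq> 0} \<union> {x \<in> cart_prod K. g x = 0} = cart_prod K" by auto
    finally show ?thesis .
  qed
  ultimately have "card (K i) * (min_weight K d + card (cart_prod (K(i := T)))) \<le> card (K i) * card (cart_prod K)"
    unfolding zeros by simp
  then show ?thesis by (simp add: distrib_left count)
qed

subsection \<open>Affine equivalence\<close>

lemma axis_add: "axis i (s + t :: 'a::ring_1) = axis i s + axis i t"
  by (simp add: axis_def vec_eq_iff)

lemma scale_axis: "s *s axis i t = axis i (s * t :: 'a::ring_1)"
  by (simp add: axis_def vec_eq_iff)

context finite_subfield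
begin

text \<open>If \<open>A\<close> is strictly larger than \<open>K\<close>, then \<open>h\<close> takes each of the \<open>d\<close> values in \<open>T\<close> at least
  twice, so that the univariate polynomial \<open>p (axis i t)\<close> has more than \<open>d\<close> roots.\<close>

lemma linear_form_on_axis:
  assumes A: "subfield_of_type A" "K \<subseteq> A" and p: "poly_fun d p"
    and h: "\<And>t. t \<in> A \<Longrightarrow> h t \<in> K" "\<And>s t. s \<in> A \<Longrightarrow> t \<in> A \<Longrightarrow> h (s + t) = h s + h t"
      "\<And>s t. s \<in> K \<Longrightarrow> t \<in> A \<Longrightarrow> h (s * t) = s * h t"
    and ph: "\<And>t. t \<in> A \<Longrightarrow> p (axis i t) = c * (\<Prod>\<alpha>\<in>T. h t - \<alpha>)"
    and T: "T \<subseteq> K" "card T = d" "1 \<le> d" "d < card K" and "c \<noteq> 0"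
    and t0: "t0 \<in> A" "h t0 \<noteq> 0"
  shows "A = K"
proof (rule ccontr)
  assume "A \<noteq> K"
  interpret A: finite_subfield A by unfold_locales (rule A)
  have "card K < card A" using A(2) \<open>A \<noteq> K\<close> by (simp add: psubset_card_mono psubsetI)
  moreover have "h ` A \<subseteq> K" using h(1) by blast
  \<comment> \<open>Pigeonhole: the additive map \<open>h\<close> into the smaller set
    \<open>K\<close> has a nonzero kernel element \<open>u\<close>.\<close>
  ultimately have "\<not> inj_on h A" by (meson card_inj_on_le finite linorder_not_le)
  then obtain s t where st: "s \<in> A" "t \<in> A" "s \<noteq> t" "h s = h t" by (auto simp: inj_on_def)
  define u where "u = s - t"
  have u: "u \<in> A" "u \<noteq> 0" using st by (auto simp: u_def A.diff_closed)
  have "h s = h t + h u" using h(2)[OF st(2) u(1)] by (simp add: u_def)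
  then have hu: "h u = 0" using st by simp
  \<comment> \<open>A section of \<open>h\<close> over \<open>K\<close>, obtained by scaling the
    point \<open>t0\<close> where \<open>h\<close> is nonzero.\<close>
  define g where "g \<alpha> = (\<alpha> * inverse (h t0)) * t0" for \<alpha>
  have gA: "g \<alpha> \<in> A" and hg: "h (g \<alpha>) = \<alpha>" if "\<alpha> \<in> K" for \<alpha>
  proof -
    have "\<alpha> * inverse (h t0) \<in> K" using that h(1) t0 by (simp add: mult_closed inverse_closed)
    moreover from this have "\<alpha> * inverse (h t0) \<in> A" using A(2) by blast
    ultimately show "g \<alpha> \<in> A" "h (g \<alpha>) = \<alpha>"
      unfolding g_def using t0 by (simp_all add: h(3) A.mult_closed del: mult.assoc)
  qed
  obtain b where b: "\<And>x t. p (x + t *s axis i 1) = (\<Sum>j\<le>d. t ^ j * b j x)"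
    using poly_fun_line[OF p] by metis
  have pb: "p (axis i t) = (\<Sum>j\<le>d. t ^ j * b j 0)" for t
    using b[of 0 t] by (simp add: scale_axis)
  have "inj_on g T" using hg T(1) by (metis inj_onI subsetD)
  then have "card (g ` T) = d" using T by (simp add: card_image)
  have root: "p (axis i (g \<alpha>)) = 0" if "\<alpha> \<in> T" for \<alpha>
    using that T(1) by (subst ph) (auto simp: gA hg intro!: prod_zero)
  have fact: "p (axis i t) = b d 0 * (\<Prod>\<beta>\<in>g ` T. t - \<beta>)" for t
    unfolding pb using \<open>card (g ` T) = d\<close> root by (intro poly_eq_prod_roots) (auto simp: pb)
  obtain \<alpha> where \<alpha>: "\<alpha> \<in> T" using T by (metis card.empty ex_in_conv not_one_le_zero)
  then have "\<alpha> \<in> K" using T by blast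
  have hgu: "h (g \<alpha> + u) = \<alpha>" using h(2) hg gA u hu \<open>\<alpha> \<in> K\<close> by simp
  have "g \<alpha> + u \<notin> g ` T"
  proof
    assume "g \<alpha> + u \<in> g ` T"
    then obtain \<beta> where "\<beta> \<in> T" "g \<alpha> + u = g \<beta>" by blast
    then have "\<beta> = \<alpha>" using hgu hg T(1) by auto
    then show False using \<open>g \<alpha> + u = g \<beta>\<close> u by simp
  qed
  then have "(\<Prod>\<beta>\<in>g ` T. (g \<alpha> + u) - \<beta>) \<noteq> 0" by (auto simp: prod_zero_iff)
  moreover have "p (axis i (g \<alpha> + u)) = 0"
    using \<alpha> \<open>\<alpha> \<in> K\<close> gA u by (subst ph) (auto simp: hgu A.add_closed intro!: prod_zero)
  ultimately have "b d 0 = 0" using fact by simp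
  \<comment> \<open>With leading coefficient 0 the function \<open>p\<close> would vanish on the
    whole axis, yet \<open>h\<close> also takes values outside \<open>T\<close>, as
    \<open>d < card K\<close>.\<close>
  obtain \<beta> where \<beta>: "\<beta> \<in> K" "\<beta> \<notin> T" using T by (metis less_irrefl subsetI subset_antisym)
  have "p (axis i (g \<beta>)) \<noteq> 0"
    using \<beta> gA hg \<open>c \<noteq> 0\<close> by (subst ph) (auto simp: prod_zero_iff)
  then show False using fact \<open>b d 0 = 0\<close> by simp
qed

end

section \<open>Linear forms on X in coordinates\<close>

lemma subspace_over_cart_prod:
  assumes "subfield_of_type k" "\<And>i. subfield_of_type (K i)" "\<And>i. k \<subseteq> K i"
  shows "finite_subfield.subspace_over k (cart_prod K)"
proof -
  interpret finite_subfield k by unfold_locales (rule assms)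
  show ?thesis
    using assms(2,3) unfolding subspace_over_def
    by (auto simp: cart_prod_def subfield_of_type_def subset_iff)
qed

lemma axis_in_cart_prod:
  assumes "\<And>j. 0 \<in> K j"
  shows "axis i t \<in> cart_prod K \<longleftrightarrow> t \<in> K i"
  using assms by (auto simp: cart_prod_def axis_def)

lemma additive_sum_axis:
  fixes x :: "'a::{field,finite} ^ 'n::finite"
  assumes "subfield_of_type k" "finite_subfield.subspace_over k V" "\<And>i. axis i (x $ i) \<in> V"
    "\<And>x y. x \<in> V \<Longrightarrow> y \<in> V \<Longrightarrow> L (x + y) = L x + L y"
  shows "L x = (\<Sum>i\<in>UNIV. L (axis i (x $ i)) :: 'a)"
proof -
  interpret finite_subfield k by unfold_locales (rule assms)
  have "L (0 + 0) = L 0 + L 0" by (rule assms(4)) (rule subspace_overD(1)[OF assms(2)])+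
  then have L0: "L 0 = 0" by (simp only: add_0_right add_cancel_right_right)
  \<comment> \<open>Additivity of \<open>L\<close> is known on \<open>V\<close> only, so membership
    of the partial sums is carried through the induction.\<close>
  have "(\<Sum>i\<in>S. axis i (x $ i)) \<in> V \<and> L (\<Sum>i\<in>S. axis i (x $ i)) = (\<Sum>i\<in>S. L (axis i (x $ i)))"
    if "finite S" for S
    using that
    by (induction S) (auto simp: L0 subspace_overD(1,2)[OF assms(2)] assms(3,4))
  moreover have "(\<Sum>i\<in>UNIV. axis i (x $ i)) = x"
    by (simp add: vec_eq_iff axis_def if_distrib cong: if_cong)
  ultimately show ?thesis by (metis finite)
qed

lemma linear_form_change_of_coordinates:
  fixes K :: "'n::finite \<Rightarrow> 'a::{field,finite} set"
  assumes b: "b k \<noteq> 0" "K k = K j" and form: "\<And>x. x \<in> cart_prod K \<Longrightarrow> (\<Sum>i\<in>UNIV. b i * x $ i) \<in> K j"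
  obtains \<phi> where "\<phi> \<in> affine_group_on K" "\<And>x. x \<in> cart_prod K \<Longrightarrow> \<phi> x \<in> cart_prod K"
    "\<And>x. x \<in> cart_prod K \<Longrightarrow> \<phi> x $ j = (\<Sum>i\<in>UNIV. b i * x $ i)"
proof -
  \<comment> \<open>Coordinate \<open>j\<close> becomes the linear form and the old coordinate
    \<open>j\<close> is stored at position \<open>k\<close>, which stays inside X because
    \<open>K k = K j\<close>. For \<open>k = j\<close> the row of the form takes precedence. The
    lost coordinate \<open>x $ k\<close> is recovered from the form since \<open>b k\<close> is
    nonzero.\<close>
  define A :: "'a ^ 'n ^ 'n" where
    "A = (\<chi> i l. if i = j then b l else if i = k then (if l = j then 1 else 0) else (if l = i then 1 else 0))"
  have A: "(A *v x) $ i = (if i = j then \<Sum>l\<in>UNIV. b l * x $ l else if i = k then x $ j else x $ i)" for x i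
    by (simp add: A_def matrix_vector_mult_def if_distrib[of "\<lambda>y. y * _"] cong: if_cong)
  have "x = 0" if "A *v x = 0" for x
  proof -
    have 0: "(A *v x) $ i = 0" for i by (simp add: that)
    have x0: "x $ i = 0" if "i \<noteq> k" for i
      using 0[of i] 0[of k] that by (auto simp: A split: if_splits)
    have "(\<Sum>l\<in>UNIV. b l * x $ l) = b k * x $ k"
      by (subst sum.remove[of _ k]) (auto simp: x0)
    then have "x $ k = 0" using 0[of j] b(1) by (simp add: A)
    then show "x = 0" using x0 by (metis vec_eq_iff zero_index)
  qed
  then have "invertible A"
    by (simp add: invertible_left_inverse matrix_left_invertible_ker)
  then have inj: "inj ((*v) A)"
    by (metis invertible_left_inverse matrix_left_invertible_injective)
  have maps: "A *v x \<in> cart_prod K" if "x \<in> cart_prod K" for x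
    using that form[OF that] b(2) by (auto simp: cart_prod_def A)
  \<comment> \<open>An injective map of the finite set X into itself is onto.\<close>
  have "(\<lambda>x. A *v x + 0) ` cart_prod K = cart_prod K"
    using maps inj by (intro endo_inj_surj) (auto intro: inj_on_subset)
  moreover have "(\<lambda>x. A *v x + 0) \<in> affine_group"
    using \<open>invertible A\<close> unfolding affine_group_def by blast
  ultimately have "restrict (\<lambda>x. A *v x + 0) (cart_prod K) \<in> affine_group_on K"
    unfolding affine_group_on_def by blast
  then show thesis by (rule that) (simp_all add: maps A)
qed

section \<open>Classification of the minimal weight codewords\<close>

theorem proposition3p1:
  fixes K :: "'n::{finite,linorder} \<Rightarrow> 'a::{field,finite} set"
    and d l :: nat
    and f :: "('a, 'n) vec \<Rightarrow> 'a"
  assumes subfields: "\<And>i. subfield_of_type (K i)"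
    and chain: "\<And>i j. i \<le> j \<Longrightarrow> K i \<subseteq> K j"
    and d: "1 \<le> d" "d < card (K first_index)"
    and l: "l = d"
    and codeword: "f \<in> code K d" "f \<noteq> zero_fun K"
    and minimal: "weight K f = min_weight K d"
  shows "\<exists>\<sigma> \<alpha>. \<sigma> \<noteq> 0 \<and>
           (\<forall>i\<in>{1..l}. \<alpha> i \<in> K first_index) \<and>
           (\<forall>i\<in>{1..l}. \<forall>j\<in>{1..l}. i \<noteq> j \<longrightarrow> \<alpha> i \<noteq> \<alpha> j) \<and>
           code_equiv K f
             (\<lambda>x\<in>cart_prod K. \<sigma> * (\<Prod>i=1..l. x $ first_index - \<alpha> i))"
proof -
  define k where "k = K first_index"
  let ?X = "cart_prod K"
  have kK: "k \<subseteq> K i" for i unfolding k_def by (rule chain) (simp add: first_index_def)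
  interpret finite_subfield k by unfold_locales (simp add: k_def subfields)
  have nonempty: "K i \<noteq> {}" and zero: "0 \<in> K i" for i
    using subfields[of i] by (auto simp: subfield_of_type_def)
  have subX: "subspace_over ?X"
    by (rule subspace_over_cart_prod[OF subfield subfields kK])
  have ext: "f \<in> extensional ?X" using codeword by (auto simp: code_def code_algebra_def PiE_def)
  obtain p where p: "poly_fun d p" "\<And>x. x \<in> ?X \<Longrightarrow> f x = p x"
    using poly_fun_of_code[OF nonempty codeword] by metis
  have nz: "\<exists>x\<in>?X. p x \<noteq> 0"
  proof (rule ccontr)
    assume "\<not> (\<exists>x\<in>?X. p x \<noteq> 0)"
    then have "f = zero_fun K"
      using ext p(2) by (intro extensionalityI[of _ ?X]) (auto simp: zero_fun_def)
    then show False using codeword by simp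
  qed
  have dk: "d < card k" using d(2) by (simp add: k_def)
  \<comment> \<open>The upper bound on the zeros is \<open>schwartz_zippel\<close>; the lower bound
    compares the minimal weight with that of an explicit product.\<close>
  have extremal: "card k * card {x \<in> ?X. p x = 0} = d * card ?X"
  proof (rule antisym)
    obtain N where "has_dim N ?X" using exists_has_dim[OF subX] by blast
    from schwartz_zippel[OF this p(1), of 0] nz
    show "card k * card {x \<in> ?X. p x = 0} \<le> d * card ?X" by simp
    have "weight K f + card {x \<in> ?X. p x = 0} = card ({x \<in> ?X. f x \<noteq> 0} \<union> {x \<in> ?X. p x = 0})"
      unfolding weight_def using p(2) by (intro card_Un_disjoint[symmetric]) auto
    also have "{x \<in> ?X. f x \<noteq> 0} \<union> {x \<in> ?X. p x = 0} = ?X" using p(2) by auto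
    finally have "card k * card ?X = card k * weight K f + card k * card {x \<in> ?X. p x = 0}"
      by (metis distrib_left)
    moreover have "card k * weight K f + d * card ?X \<le> card k * card ?X"
      using min_weight_le_example[of K, OF nonempty d(2)] minimal by (simp add: k_def)
    ultimately show "d * card ?X \<le> card k * card {x \<in> ?X. p x = 0}" by linarith
  qed
  obtain T c L where T: "T \<subseteq> k" "card T = d" and "c \<noteq> 0"
    and L: "\<And>x. x \<in> ?X \<Longrightarrow> L x \<in> k" "\<And>x y. x \<in> ?X \<Longrightarrow> y \<in> ?X \<Longrightarrow> L (x + y) = L x + L y"
      "\<And>t x. t \<in> k \<Longrightarrow> x \<in> ?X \<Longrightarrow> L (t *s x) = t * L x" "\<exists>x\<in>?X. L x \<noteq> 0"
    and pL: "\<And>x. x \<in> ?X \<Longrightarrow> p x = c * (\<Prod>\<alpha>\<in>T. L x - \<alpha>)"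
    by (rule extremal_linear_form[OF subX p(1) nz d(1) dk extremal]) (rule that)
  have axis: "axis i t \<in> ?X \<longleftrightarrow> t \<in> K i" for i t
    by (rule axis_in_cart_prod) (rule zero)
  \<comment> \<open>A form that is nonzero on an axis forces \<open>K i = k\<close> there, so larger
    subfields contribute nothing to \<open>L\<close>.\<close>
  have vanish: "L (axis i t) = 0" if "K i \<noteq> k" "t \<in> K i" for i t
  proof (rule ccontr)
    assume "L (axis i t) \<noteq> 0"
    have "K i = k"
    proof (rule linear_form_on_axis[OF subfields kK p(1), of i "\<lambda>t. L (axis i t)"])
      show "L (axis i s) \<in> k" if "s \<in> K i" for s using that L(1) axis by blast
      show "L (axis i (s + s')) = L (axis i s) + L (axis i s')" if "s \<in> K i" "s' \<in> K i" for s s'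
        using that L(2) axis by (simp add: axis_add)
      show "L (axis i (s * s')) = s * L (axis i s')" if "s \<in> k" "s' \<in> K i" for s s'
        using L(3)[of s "axis i s'"] that axis by (simp add: scale_axis)
      show "p (axis i s) = c * (\<Prod>\<alpha>\<in>T. L (axis i s) - \<alpha>)" if "s \<in> K i" for s
        using that pL axis by blast
    qed (use T d \<open>c \<noteq> 0\<close> that \<open>L (axis i t) \<noteq> 0\<close> in \<open>auto simp: k_def\<close>)
    then show False using that by simp
  qed
  define b where "b i = L (axis i 1)" for i
  have one: "1 \<in> K i" for i using kK one_closed by blast
  have Lb: "L x = (\<Sum>i\<in>UNIV. b i * x $ i)" if x: "x \<in> ?X" for x
  proof -
    have coord: "x $ i \<in> K i" for i using x by (simp add: cart_prod_def)
    have "L x = (\<Sum>i\<in>UNIV. L (axis i (x $ i)))"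
      using coord by (intro additive_sum_axis[OF subfield subX] L(2)) (auto simp: axis)
    also have "\<dots> = (\<Sum>i\<in>UNIV. b i * x $ i)"
    proof (rule sum.cong[OF refl])
      fix i
      show "L (axis i (x $ i)) = b i * x $ i"
      \<comment> \<open>If \<open>K i = k\<close>, the coordinate is a scalar and can be pulled out
        of \<open>L\<close>; otherwise \<open>vanish\<close> makes both sides zero.\<close>
      proof (cases "K i = k")
        case True
        then show ?thesis
          using L(3)[of "x $ i" "axis i 1"] coord[of i] one axis
          by (simp add: scale_axis b_def mult.commute)
      next
        case False
        then show ?thesis using vanish coord one by (simp add: b_def)
      qed
    qed
    finally show ?thesis .
  qed
  obtain m where m: "b m \<noteq> 0"
  proof (rule ccontr)
    assume "\<not> thesis"
    then have "b i = 0" for i using that by blast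
    then show False using L(4) Lb by auto
  qed
  \<comment> \<open>The contrapositive of \<open>vanish\<close> at the vector
    \<open>axis m 1\<close>: this is what allows the coordinates \<open>m\<close> and
    \<open>first_index\<close> to be exchanged within X.\<close>
  then have "K m = K first_index" using vanish[of m 1] one by (auto simp: b_def k_def)
  have form: "(\<Sum>i\<in>UNIV. b i * x $ i) \<in> K first_index" if "x \<in> ?X" for x
    using Lb[OF that] L(1)[OF that] by (simp add: k_def)
  obtain \<phi> where \<phi>: "\<phi> \<in> affine_group_on K" "\<And>x. x \<in> ?X \<Longrightarrow> \<phi> x \<in> ?X"
    "\<And>x. x \<in> ?X \<Longrightarrow> \<phi> x $ first_index = (\<Sum>i\<in>UNIV. b i * x $ i)"
    by (rule linear_form_change_of_coordinates[of b m K first_index, OF m \<open>K m = K first_index\<close> form]) (assumption | rule that)+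
  obtain \<alpha> where \<alpha>: "bij_betw \<alpha> {1..d} T"
    using ex_bij_betw_nat_finite_1[of T] T(2) by auto
  define g where "g = (\<lambda>x\<in>?X. c * (\<Prod>i=1..d. x $ first_index - \<alpha> i))"
  have "f = compose ?X g \<phi>"
  proof (rule extensionalityI[OF ext compose_extensional])
    fix x assume x: "x \<in> ?X"
    have "(\<Prod>\<alpha>\<in>T. L x - \<alpha>) = (\<Prod>i=1..d. L x - \<alpha> i)"
      by (rule prod.reindex_bij_betw[OF \<alpha>, symmetric])
    then show "f x = compose ?X g \<phi> x"
      using x \<phi> p(2) pL Lb by (simp add: compose_def g_def)
  qed
  then have "code_equiv K f g" unfolding code_equiv_def using \<phi>(1) by blast
  moreover have "\<alpha> i \<in> K first_index" if "i \<in> {1..d}" for i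
    using bij_betwE[OF \<alpha>] T(1) that by (auto simp: k_def)
  moreover have "\<alpha> i \<noteq> \<alpha> j" if "i \<in> {1..d}" "j \<in> {1..d}" "i \<noteq> j" for i j
    using inj_on_eq_iff[OF bij_betw_imp_inj_on[OF \<alpha>] that(1,2)] that(3) by simp
  ultimately show ?thesis
    unfolding l g_def using \<open>c \<noteq> 0\<close>
    by (intro exI[of _ c] exI[of _ \<alpha>] conjI ballI impI) simp_all
qed

end
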